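(* Let $\mathbf{A}$ be a finite idempotent algebra and $B$ a subuniverse of $\mathbf{A}$. Then the following are equivalent: (i) $B$ absorbs $\mathbf{A}$; (ii) $B$ Jónsson absorbs $\mathbf{A}$ and $\mathbf{A}$ has no $B$-blocker.
   Context: An algebra is idempotent if every basic operation $f$ satisfies $f(x,\dots,x)\approx x$. Absorption: a subuniverse $B$ of $\mathbf{A}$ absorbs $\mathbf{A}$ if there is an idempotent term $t$ of $\mathbf{A}$, say $n$-ary, such that $t(a_1,\dots,a_n)\in B$ whenever all but at most one of the $a_i$ lie in $B$ and the remaining one lies in $A$. Jónsson absorption: a subuniverse $B$ of $\mathbf{A}$ Jónsson absorbs $\mathbf{A}$ if there are ternary terms $d_0,\dots,d_n$ of $\mathbf{A}$ such that $d_i(b,a,b')\in B$ for all $i$, all $b,b'\in B$, $a\in A$; $d_i(x,y,y)=d_{i+1}(x,x,y)$ for all $i<n$ and all $x,y\in A$; $d_0(x,y,z)=x$ and $d_n(x,y,z)=z$ for all $x,y,z\in A$. $B$-blocker: for a subuniverse $B$ of $\mathbf{A}$, a pair $(C,D)$ of subsets of $A$ is a $B$-blocker of $\mathbf{A}$ if (1) $D$ is a subuniverse of $\mathbf{A}$; (2) $\emptyset\neq C\subseteq D$; (3) $C\cap B=\emptyset$; (4) $D\cap B\neq\emptyset$; (5) for every $n\ge 1$, the set $D^n\setminus (D\setminus C)^n$ is a subuniverse of $\mathbf{A}^n$. *)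

theory Defs
  imports Main
begin

definition is_algebra :: "'a set \<Rightarrow> (nat \<times> ('a list \<Rightarrow> 'a)) set \<Rightarrow> bool" where
  "is_algebra A F \<longleftrightarrow>
     (\<forall>(m, f) \<in> F. \<forall>xs. length xs = m \<and> set xs \<subseteq> A \<longrightarrow> f xs \<in> A)"

definition idempotent_alg :: "'a set \<Rightarrow> (nat \<times> ('a list \<Rightarrow> 'a)) set \<Rightarrow> bool" where
  "idempotent_alg A F \<longleftrightarrow> (\<forall>(m, f) \<in> F. \<forall>x \<in> A. f (replicate m x) = x)"

text \<open>n-ary term operations: the clone generated by the basic operations
  (functions are only relevant on argument lists from A of length n).\<close>

inductive_set term_ops :: "(nat \<times> ('a list \<Rightarrow> 'a)) set \<Rightarrow> nat \<Rightarrow> ('a list \<Rightarrow> 'a) set"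
  for F :: "(nat \<times> ('a list \<Rightarrow> 'a)) set" and n :: nat where
  proj: "i < n \<Longrightarrow> (\<lambda>xs. xs ! i) \<in> term_ops F n"
| comp: "(m, f) \<in> F \<Longrightarrow> length gs = m \<Longrightarrow> (\<forall>g \<in> set gs. g \<in> term_ops F n)
          \<Longrightarrow> (\<lambda>xs. f (map (\<lambda>g. g xs) gs)) \<in> term_ops F n"

definition subuniverse :: "'a set \<Rightarrow> (nat \<times> ('a list \<Rightarrow> 'a)) set \<Rightarrow> 'a set \<Rightarrow> bool" where
  "subuniverse A F B \<longleftrightarrow> B \<subseteq> A \<and>
     (\<forall>(m, f) \<in> F. \<forall>xs. length xs = m \<and> set xs \<subseteq> B \<longrightarrow> f xs \<in> B)"

definition subuniverse_pow :: "'a set \<Rightarrow> (nat \<times> ('a list \<Rightarrow> 'a)) set \<Rightarrow> nat \<Rightarrow> 'a list set \<Rightarrow> bool" where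
  "subuniverse_pow A F n S \<longleftrightarrow> S \<subseteq> {xs. length xs = n \<and> set xs \<subseteq> A} \<and>
     (\<forall>(m, f) \<in> F. \<forall>ts. length ts = m \<and> set ts \<subseteq> S \<longrightarrow>
        map (\<lambda>i. f (map (\<lambda>t. t ! i) ts)) [0..<n] \<in> S)"

definition tuples :: "nat \<Rightarrow> 'a set \<Rightarrow> 'a list set" where
  "tuples n X = {xs. length xs = n \<and> set xs \<subseteq> X}"

definition absorbs :: "'a set \<Rightarrow> (nat \<times> ('a list \<Rightarrow> 'a)) set \<Rightarrow> 'a set \<Rightarrow> bool" where
  "absorbs A F B \<longleftrightarrow> (\<exists>n. \<exists>t \<in> term_ops F n.
     (\<forall>x \<in> A. t (replicate n x) = x) \<and>
     (\<forall>as. length as = n \<and> set as \<subseteq> A \<and> card {i. i < n \<and> as ! i \<notin> B} \<le> 1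
            \<longrightarrow> t as \<in> B))"

definition jonsson_absorbs :: "'a set \<Rightarrow> (nat \<times> ('a list \<Rightarrow> 'a)) set \<Rightarrow> 'a set \<Rightarrow> bool" where
  "jonsson_absorbs A F B \<longleftrightarrow> (\<exists>n ds. length ds = Suc n \<and>
     (\<forall>d \<in> set ds. d \<in> term_ops F 3) \<and>
     (\<forall>i \<le> n. \<forall>b \<in> B. \<forall>b' \<in> B. \<forall>a \<in> A. (ds ! i) [b, a, b'] \<in> B) \<and>
     (\<forall>i < n. \<forall>x \<in> A. \<forall>y \<in> A. (ds ! i) [x, y, y] = (ds ! Suc i) [x, x, y]) \<and>
     (\<forall>x \<in> A. \<forall>y \<in> A. \<forall>z \<in> A. (ds ! 0) [x, y, z] = x \<and> (ds ! n) [x, y, z] = z))"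

definition blocker :: "'a set \<Rightarrow> (nat \<times> ('a list \<Rightarrow> 'a)) set \<Rightarrow> 'a set \<Rightarrow> 'a set \<Rightarrow> 'a set \<Rightarrow> bool" where
  "blocker A F B C D \<longleftrightarrow>
     subuniverse A F D \<and> C \<noteq> {} \<and> C \<subseteq> D \<and> C \<inter> B = {} \<and> D \<inter> B \<noteq> {} \<and>
     (\<forall>n \<ge> 1. subuniverse_pow A F n (tuples n D - tuples n (D - C)))"

end

theory Submission
  imports Defs "HOL-Library.Ramsey"
begin

text \<open>
  For (ii) implies (i), suppose \<open>B\<close> Jonsson absorbs but does not absorb. Ramsey's theorem provides
  a single triple \<open>(\<beta>, \<xi>, \<alpha>)\<close> with \<open>\<beta>, \<alpha> \<in> B\<close> such that the infinite sequences \<open>row \<beta> \<xi> \<alpha> i\<close> generate no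
  sequence over \<open>B\<close>. Starting from this relation one splits off, one after the other, as many
  ``hub'' coordinates as desired, each with a subuniverse \<open>D c\<close> meeting \<open>B\<close> and an element
  \<open>y c \<in> D c\<close>, in such a way that a hub tuple extends to a sequence over \<open>B\<close> as soon as one of its
  entries is the corresponding \<open>y c\<close>, but no hub tuple over \<open>B\<close> does. On the other hand, the absence of
  blockers provides one term \<open>t\<close> that maps, for all such \<open>D\<close> and \<open>y\<close> and every argument place \<open>j\<close>, some
  tuple over \<open>D\<close> with \<open>y\<close> in place \<open>j\<close> into \<open>B\<close>. Applying \<open>t\<close> to hub tuples, with as many hubs
  as \<open>t\<close> has arguments, is a contradiction.
\<close>

section \<open>Term operations\<close>

text \<open>The arity of \<open>t\<close> must be known before the number of hubs is chosen. So one
  term has to serve every pair of a subuniverse and an element at once, which the finiteness of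
  \<open>A\<close> and the composition \<open>star\<close> make possible. The Jonsson terms enter
  when a hub is split off. The values \<open>d k [\<beta>, \<beta>, \<alpha>]\<close> and
  \<open>d k [\<beta>, \<beta>, \<xi>]\<close> lead in small steps from \<open>\<beta>\<close>,
  \<open>\<beta>\<close> to \<open>\<alpha>\<close>, \<open>\<xi>\<close>. At the second end a
  sequence continues inside \<open>B\<close>, at the first end \<open>bad\<close> forbids this, and
  the place where the status changes supplies the new hub. The element \<open>\<xi>\<close> can be
  moved along a sequence because \<open>d k [\<beta>, \<xi>, \<alpha>]\<close> lies in
  \<open>B\<close>. Each split consumes a prefix whose length cannot be bounded beforehand.
  Therefore the sequences are infinite, with a constant tail \<open>\<alpha>\<close>.\<close>

lemma term_subst:
  assumes "t \<in> term_ops F n" and g: "\<And>j. j < n \<Longrightarrow> g j \<in> term_ops F m"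
  shows "(\<lambda>xs. t (map (\<lambda>j. g j xs) [0..<n])) \<in> term_ops F m"
  using assms(1)
proof induction
  case (proj i)
  then show ?case using g[of i] by simp
next
  case (comp k f gs)
  have "(\<lambda>xs. f (map (\<lambda>h. h xs) (map (\<lambda>h xs. h (map (\<lambda>j. g j xs) [0..<n])) gs))) \<in> term_ops F m"
    using comp by (intro term_ops.comp) auto
  then show ?case by (simp add: comp_def)
qed

lemma term_reindex:
  assumes "t \<in> term_ops F n" "\<And>j. j < n \<Longrightarrow> \<pi> j < m"
  shows "(\<lambda>xs. t (map (\<lambda>j. xs ! \<pi> j) [0..<n])) \<in> term_ops F m"
  using term_subst[OF assms(1), of "\<lambda>j xs. xs ! \<pi> j"] assms(2) by (simp add: term_ops.proj)

lemma basic_term: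
  assumes "(m, f) \<in> F"
  shows "(\<lambda>xs. f (map (\<lambda>j. xs ! j) [0..<m])) \<in> term_ops F m"
proof -
  have "(\<lambda>xs. f (map (\<lambda>g. g xs) (map (\<lambda>j xs. xs ! j) [0..<m]))) \<in> term_ops F m"
    using assms by (intro term_ops.comp) (auto intro: term_ops.proj)
  then show ?thesis by (simp add: comp_def)
qed

lemma subuniverse_pow_term:
  assumes S: "subuniverse_pow A F n S" and "t \<in> term_ops F m" and ts: "length ts = m" "set ts \<subseteq> S"
  shows "map (\<lambda>i. t (map (\<lambda>x. x ! i) ts)) [0..<n] \<in> S"
  using assms(2)
proof induction
  case (proj k)
  then have k: "ts ! k \<in> S" using ts by auto
  then have "length (ts ! k) = n" using S by (auto simp: subuniverse_pow_def)
  then have "map (\<lambda>i. map (\<lambda>x. x ! i) ts ! k) [0..<n] = ts ! k"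
    using proj ts by (auto intro!: nth_equalityI)
  then show ?case using k by simp
next
  case (comp k f gs)
  let ?us = "map (\<lambda>g. map (\<lambda>i. g (map (\<lambda>x. x ! i) ts)) [0..<n]) gs"
  have "map (\<lambda>i. f (map (\<lambda>t. t ! i) ?us)) [0..<n] \<in> S"
  proof -
    have "length ?us = k" "set ?us \<subseteq> S" using comp by auto
    then show ?thesis using S comp(1) unfolding subuniverse_pow_def by blast
  qed
  moreover have "map (\<lambda>i. f (map (\<lambda>t. t ! i) ?us)) [0..<n]
      = map (\<lambda>i. f (map (\<lambda>g. g (map (\<lambda>x. x ! i) ts)) gs)) [0..<n]"
    by (auto simp: comp_def intro!: arg_cong[where f=f])
  ultimately show ?case by metis
qed

definition closed_under :: "(nat \<times> ('a list \<Rightarrow> 'a)) set \<Rightarrow> 'a set \<Rightarrow> bool" where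
  "closed_under F S \<longleftrightarrow>
     (\<forall>n. \<forall>t \<in> term_ops F n. \<forall>e. (\<forall>j<n. e j \<in> S) \<longrightarrow> t (map e [0..<n]) \<in> S)"

lemma closed_underD:
  assumes "closed_under F S" "t \<in> term_ops F n" "\<And>j. j < n \<Longrightarrow> e j \<in> S"
  shows "t (map e [0..<n]) \<in> S"
  using assms unfolding closed_under_def by blast

lemma subuniverse_closed:
  assumes S: "subuniverse A F S"
  shows "closed_under F S"
  unfolding closed_under_def
proof (intro allI ballI impI)
  fix n t and e :: "nat \<Rightarrow> 'a" assume "t \<in> term_ops F n" and e: "\<forall>j<n. e j \<in> S"
  then show "t (map e [0..<n]) \<in> S"
  proof induction
    case (comp m f gs)
    then have "set (map (\<lambda>g. g (map e [0..<n])) gs) \<subseteq> S" by auto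
    with comp(1,2) show ?case using S unfolding subuniverse_def by auto
  qed auto
qed

lemma closed_subuniverse:
  assumes S: "closed_under F S" "S \<subseteq> A"
  shows "subuniverse A F S"
proof -
  have "f xs \<in> S" if f: "(m, f) \<in> F" and xs: "length xs = m" "set xs \<subseteq> S" for m f xs
  proof -
    have "map (\<lambda>j. map (\<lambda>j. xs ! j) [0..<m] ! j) [0..<m] = xs"
      using xs(1) by (auto intro!: nth_equalityI)
    then show ?thesis
      using closed_underD[OF S(1) basic_term[OF f], of "\<lambda>j. xs ! j"] xs
      by (metis nth_mem subsetD)
  qed
  then show ?thesis using S(2) by (auto simp: subuniverse_def)
qed

text \<open>The star composition of absorption theory: every argument of \<open>t\<close> is a copy
  of \<open>s\<close> with its own block of \<open>m\<close> variables.\<close>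

definition star :: "nat \<Rightarrow> nat \<Rightarrow> ('a list \<Rightarrow> 'a) \<Rightarrow> ('a list \<Rightarrow> 'a) \<Rightarrow> 'a list \<Rightarrow> 'a" where
  "star N m t s = (\<lambda>xs. t (map (\<lambda>j. s (map (\<lambda>k. xs ! (j * m + k)) [0..<m])) [0..<N]))"

lemma block_index:
  fixes m :: nat
  assumes "j < N" "k < m"
  shows "j * m + k < N * m"
proof -
  have "j * m + k < Suc j * m" "Suc j * m \<le> N * m" using assms by (simp, intro mult_le_mono1) simp
  then show ?thesis by (rule less_le_trans)
qed

lemma star_term:
  assumes "t \<in> term_ops F N" "s \<in> term_ops F m"
  shows "star N m t s \<in> term_ops F (N * m)"
  unfolding star_def using assms
  by (intro term_subst[where g = "\<lambda>j xs. s (map (\<lambda>k. xs ! (j * m + k)) [0..<m])"] term_reindex)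
     (auto intro: block_index)

lemma star_eval:
  "star N m t s (map e [0..<N * m]) = t (map (\<lambda>j. s (map (\<lambda>k. e (j * m + k)) [0..<m])) [0..<N])"
proof -
  have "map e [0..<N * m] ! (j * m + k) = e (j * m + k)" if "j < N" "k < m" for j k
    using block_index[OF that] by simp
  then show ?thesis unfolding star_def
    by (intro arg_cong[where f=t] map_cong refl arg_cong[where f=s]) auto
qed

section \<open>Consequences of absorption and of the absence of blockers\<close>

locale idempotent_pair =
  fixes A :: "'a set" and F :: "(nat \<times> ('a list \<Rightarrow> 'a)) set" and B :: "'a set"
  assumes alg: "is_algebra A F" and fin: "finite A" and idem: "idempotent_alg A F"
    and sub: "subuniverse A F B"
begin

lemma BA: "B \<subseteq> A"
  using sub by (simp add: subuniverse_def)

lemma closed_B: "closed_under F B"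
  using sub by (rule subuniverse_closed)

lemma closed_A: "closed_under F A"
  using alg by (intro subuniverse_closed) (auto simp: subuniverse_def is_algebra_def)

lemma term_idem:
  assumes "t \<in> term_ops F n" "x \<in> A"
  shows "t (map (\<lambda>_. x) [0..<n]) = x"
  using assms(1)
proof induction
  case (comp m f gs)
  then have "map (\<lambda>g. g (map (\<lambda>_. x) [0..<n])) gs = replicate m x"
    by (auto intro!: nth_equalityI)
  then show ?case using comp(1) idem assms(2) by (auto simp: idempotent_alg_def)
qed simp

lemma term_const:
  assumes "t \<in> term_ops F n" "x \<in> A" "\<And>j. j < n \<Longrightarrow> e j = x"
  shows "t (map e [0..<n]) = x"
proof -
  have "map e [0..<n] = map (\<lambda>_. x) [0..<n]" using assms(3) by auto
  then show ?thesis using term_idem[OF assms(1,2)] by metis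
qed

text \<open>The Jonsson terms arise from \<open>t\<close> by identifying variables: in
  \<open>d i\<close> the place \<open>j\<close> with \<open>j + i = n\<close> carries the middle
  variable, earlier places the first and later places the last. For \<open>i = 0\<close> no place
  carries the middle variable, and for \<open>i = Suc n\<close> all places carry the last.\<close>

lemma absorbs_imp_jonsson:
  assumes "absorbs A F B"
  shows "jonsson_absorbs A F B"
proof -
  from assms obtain n t where t: "t \<in> term_ops F n"
    and abs: "\<And>as. length as = n \<Longrightarrow> set as \<subseteq> A \<Longrightarrow> card {i. i < n \<and> as ! i \<notin> B} \<le> 1 \<Longrightarrow> t as \<in> B"
    unfolding absorbs_def by blast
  define \<pi> where "\<pi> = (\<lambda>i j. if j + i < n then 0 else if j + i = n then 1 else (2::nat))"
  define d where "d i = (\<lambda>xs. t (map (\<lambda>j. xs ! \<pi> i j) [0..<n]))" for i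
  let ?ds = "map d [0..<Suc (Suc n)]"
  have ds: "?ds ! i = d i" if "i \<le> Suc n" for i
    using that by (simp del: upt_Suc)
  have "d i \<in> term_ops F 3" for i
    unfolding d_def by (rule term_reindex[OF t]) (auto simp: \<pi>_def)
  then have 1: "\<forall>d \<in> set ?ds. d \<in> term_ops F 3" by auto
  have 2: "d i [b, a, b'] \<in> B" if "b \<in> B" "b' \<in> B" "a \<in> A" for i b a b'
  proof -
    let ?as = "map (\<lambda>j. [b, a, b'] ! \<pi> i j) [0..<n]"
    have "{j. j < n \<and> ?as ! j \<notin> B} \<subseteq> {n - i}"
      using that by (auto simp: \<pi>_def split: if_splits)
    then have "card {j. j < n \<and> ?as ! j \<notin> B} \<le> 1"
      using card_mono[of "{n - i}"] by fastforce
    moreover have "set ?as \<subseteq> A" using that BA by (auto simp: \<pi>_def)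
    ultimately show ?thesis unfolding d_def by (intro abs) auto
  qed
  have 3: "d i [x, y, y] = d (Suc i) [x, x, y]" for i x y
    unfolding d_def by (intro arg_cong[where f=t] map_cong refl) (auto simp: \<pi>_def)
  have 4: "d 0 [x, y, z] = x" "d (Suc n) [x, y, z] = z" if "x \<in> A" "y \<in> A" "z \<in> A" for x y z
    unfolding d_def using that by (auto intro!: term_const[OF t] simp: \<pi>_def)
  show ?thesis unfolding jonsson_absorbs_def
    by (rule exI[of _ "Suc n"], rule exI[of _ ?ds]) (use 1 2 3 4 ds in \<open>auto simp del: upt_Suc\<close>)
qed

text \<open>The \<open>n\<close> tuples with one entry \<open>c\<close> and all others
  \<open>b\<close> lie in the relation of the blocker, so \<open>t\<close> maps them to a tuple with
  an entry in \<open>C\<close>. But that entry is \<open>t\<close> of a list with a single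
  \<open>c\<close> among copies of \<open>b\<close>, which absorption puts into
  \<open>B\<close>.\<close>

lemma absorbs_imp_no_blocker:
  assumes "absorbs A F B"
  shows "\<not> blocker A F B C D"
proof
  assume bl: "blocker A F B C D"
  then have DA: "D \<subseteq> A" and CD: "C \<subseteq> D" "C \<inter> B = {}"
    by (auto simp: blocker_def subuniverse_def)
  obtain c b where c: "c \<in> C" and b: "b \<in> D" "b \<in> B" using bl by (auto simp: blocker_def)
  from assms obtain n t where t: "t \<in> term_ops F n"
    and abs: "\<And>as. length as = n \<Longrightarrow> set as \<subseteq> A \<Longrightarrow> card {i. i < n \<and> as ! i \<notin> B} \<le> 1 \<Longrightarrow> t as \<in> B"
    unfolding absorbs_def by blast
  have n: "n \<ge> 1"
  proof (rule ccontr)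
    assume "\<not> n \<ge> 1"
    then have "t [] \<in> B" "t [] = c" using abs[of "[]"] term_const[OF t, of c] c CD DA by auto
    then show False using c CD by auto
  qed
  define u where "u i j = (if j = i then c else b)" for i j :: nat
  define ts where "ts = map (\<lambda>i. map (u i) [0..<n]) [0..<n]"
  have "map (\<lambda>j. t (map (\<lambda>x. x ! j) ts)) [0..<n] \<in> tuples n D - tuples n (D - C)"
  proof (rule subuniverse_pow_term[OF _ t])
    show "subuniverse_pow A F n (tuples n D - tuples n (D - C))" using bl n by (simp add: blocker_def)
    show "set ts \<subseteq> tuples n D - tuples n (D - C)"
      using c b CD by (force simp: ts_def tuples_def u_def)
  qed (simp add: ts_def)
  then obtain j where j: "j < n" "t (map (\<lambda>x. x ! j) ts) \<in> C"
    by (auto simp: tuples_def)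
  have "map (\<lambda>x. x ! j) ts = map (\<lambda>i. u i j) [0..<n]" using j by (auto simp: ts_def)
  moreover have "t (map (\<lambda>i. u i j) [0..<n]) \<in> B"
  proof (rule abs)
    have "{i. i < n \<and> map (\<lambda>i. u i j) [0..<n] ! i \<notin> B} \<subseteq> {j}"
      using b by (auto simp: u_def split: if_splits)
    then show "card {i. i < n \<and> map (\<lambda>i. u i j) [0..<n] ! i \<notin> B} \<le> 1"
      using card_mono[of "{j}"] by fastforce
  qed (use c b CD DA in \<open>auto simp: u_def\<close>)
  ultimately show False using j CD by auto
qed

text \<open>A blocker \<open>(X, D)\<close> forces every term to have a place \<open>j\<close> that violates \<open>hits t N D X\<close>;
  the lemma \<open>no_blocker_imp_hits\<close> is the converse.\<close>

definition hits :: "('a list \<Rightarrow> 'a) \<Rightarrow> nat \<Rightarrow> 'a set \<Rightarrow> 'a set \<Rightarrow> bool" where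
  "hits t N D V \<longleftrightarrow> (\<forall>j<N. \<exists>e. (\<forall>i<N. e i \<in> D) \<and> e j \<in> V \<and> t (map e [0..<N]) \<in> B)"

text \<open>Repeating each entry of a witness throughout its block suffices, since \<open>s\<close>
  is idempotent.\<close>

lemma hits_star_outer:
  assumes h: "hits t N D V" and s: "s \<in> term_ops F m" and m: "m \<ge> 1" and DA: "D \<subseteq> A"
  shows "hits (star N m t s) (N * m) D V"
  unfolding hits_def
proof (intro allI impI)
  fix l assume l: "l < N * m"
  then have j: "l div m < N" by (simp add: less_mult_imp_div_less)
  then obtain e where e: "\<forall>i<N. e i \<in> D" "e (l div m) \<in> V" "t (map e [0..<N]) \<in> B"
    using h unfolding hits_def by blast
  have "star N m t s (map (\<lambda>l. e (l div m)) [0..<N * m]) = t (map e [0..<N])"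
    unfolding star_eval using e(1) DA
    by (intro arg_cong[where f=t] map_cong refl term_const[OF s]) auto
  then show "\<exists>e. (\<forall>i<N * m. e i \<in> D) \<and> e l \<in> V \<and> star N m t s (map e [0..<N * m]) \<in> B"
    using e by (intro exI[of _ "\<lambda>l. e (l div m)"]) (auto simp: less_mult_imp_div_less)
qed

text \<open>A witness for \<open>s\<close> fills the block of the given place, and a constant from
  \<open>D\<close> and \<open>B\<close> fills the others. All blocks then have values in
  \<open>B\<close>, which \<open>t\<close> preserves.\<close>

lemma hits_star_inner:
  assumes h: "hits s m D V" and t: "t \<in> term_ops F N" and m: "m \<ge> 1" and DB: "D \<inter> B \<noteq> {}"
    and DA: "D \<subseteq> A" and s: "s \<in> term_ops F m"
  shows "hits (star N m t s) (N * m) D V"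
  unfolding hits_def
proof (intro allI impI)
  fix l assume l: "l < N * m"
  have "l mod m < m" using m by simp
  then obtain e where e: "\<forall>i<m. e i \<in> D" "e (l mod m) \<in> V" "s (map e [0..<m]) \<in> B"
    using h unfolding hits_def by blast
  obtain b where b: "b \<in> D" "b \<in> B" using DB by auto
  define e' where "e' i = (if i div m = l div m then e (i mod m) else b)" for i
  have "s (map (\<lambda>k. e' (j * m + k)) [0..<m]) \<in> B" for j
  proof (cases "j = l div m")
    case True
    then have "map (\<lambda>k. e' (j * m + k)) [0..<m] = map e [0..<m]" by (auto simp: e'_def)
    then show ?thesis using e by metis
  next
    case False
    then have "s (map (\<lambda>k. e' (j * m + k)) [0..<m]) = b"
      using b DA by (intro term_const[OF s]) (auto simp: e'_def)
    then show ?thesis using b by simp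
  qed
  then have "star N m t s (map e' [0..<N * m]) \<in> B"
    unfolding star_eval by (intro closed_underD[OF closed_B t])
  moreover have "\<forall>i<N * m. e' i \<in> D" using e b m by (auto simp: e'_def)
  moreover have "e' l \<in> V" using e by (simp add: e'_def)
  ultimately show "\<exists>e. (\<forall>i<N * m. e i \<in> D) \<and> e l \<in> V \<and> star N m t s (map e [0..<N * m]) \<in> B"
    by blast
qed

text \<open>In \<open>star\<close> the outer term keeps the pairs already served and the inner term
  adds the new one.\<close>

lemma common_hits:
  assumes "finite Q"
    and "\<And>D V. (D, V) \<in> Q \<Longrightarrow> D \<subseteq> A \<and> D \<inter> B \<noteq> {} \<and> (\<exists>N\<ge>1. \<exists>t \<in> term_ops F N. hits t N D V)"
  shows "\<exists>N\<ge>1. \<exists>t \<in> term_ops F N. \<forall>(D, V) \<in> Q. hits t N D V"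
  using assms
proof (induction rule: finite_induct)
  case empty
  show ?case using term_ops.proj[of 0 1 F] by (intro exI[of _ 1]) auto
next
  case (insert q Q)
  obtain D V where q: "q = (D, V)" by fastforce
  obtain N t where t: "N \<ge> 1" "t \<in> term_ops F N" "\<forall>(D, V) \<in> Q. hits t N D V"
    using insert.IH insert.prems by (metis (no_types, lifting) insertI2)
  obtain m s where s: "m \<ge> 1" "s \<in> term_ops F m" "hits s m D V"
    using insert.prems[of D V] q by auto
  have "hits (star N m t s) (N * m) D' V'" if "(D', V') \<in> insert q Q" for D' V'
  proof (cases "(D', V') = q")
    case True
    then show ?thesis using hits_star_inner[OF s(3) t(2) s(1) _ _ s(2)] insert.prems[of D V] q by auto
  next
    case False
    then show ?thesis using hits_star_outer[OF _ s(2,1)] t(3) insert.prems[of D' V'] that by auto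
  qed
  then show ?case using star_term[OF t(2) s(2)] t(1) s(1)
    by (intro exI[of _ "N * m"]) auto
qed

text \<open>Take \<open>X\<close> maximal among the sets between \<open>{y}\<close> and
  \<open>D\<close> that no term hits. One term \<open>t\<close> then hits all enlargements of
  \<open>X\<close> by a point of \<open>D\<close>, and composition with \<open>t\<close> shows that
  every term of positive arity has a place through which it preserves \<open>X\<close>
  (\<open>key\<close>). This makes \<open>(X, D)\<close> a blocker.\<close>

lemma no_blocker_imp_hits:
  assumes nb: "\<not> (\<exists>C D. blocker A F B C D)" and D: "subuniverse A F D" "D \<inter> B \<noteq> {}" and y: "y \<in> D"
  shows "\<exists>N\<ge>1. \<exists>t \<in> term_ops F N. hits t N D {y}"
proof (rule ccontr)
  assume neg: "\<not> ?thesis"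
  have DA: "D \<subseteq> A" using D by (simp add: subuniverse_def)
  have clD: "closed_under F D" using D(1) by (rule subuniverse_closed)
  define P where "P X \<longleftrightarrow> X \<subseteq> D \<and> y \<in> X \<and> \<not> (\<exists>N\<ge>1. \<exists>t \<in> term_ops F N. hits t N D X)" for X
  have "P {y}" using neg y by (simp add: P_def)
  moreover have "finite {X. P X}"
    by (rule finite_subset[of _ "Pow D"]) (use fin DA finite_subset in \<open>auto simp: P_def\<close>)
  ultimately obtain X where X: "P X" and max: "\<And>X'. P X' \<Longrightarrow> X \<subseteq> X' \<Longrightarrow> X = X'"
    using finite_has_maximal[of "{X. P X}"] by auto
  have XD: "X \<subseteq> D" and yX: "y \<in> X"
    and noX: "\<And>N t. N \<ge> 1 \<Longrightarrow> t \<in> term_ops F N \<Longrightarrow> \<not> hits t N D X" using X by (auto simp: P_def)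
  have XB: "X \<inter> B = {}"
  proof -
    have "\<not> hits (\<lambda>xs. xs ! 0) 1 D X" using noX term_ops.proj[of 0 1 F] by auto
    then show ?thesis using XD by (auto simp: hits_def)
  qed
  have "\<exists>N\<ge>1. \<exists>t \<in> term_ops F N. \<forall>(D', V) \<in> (\<lambda>d. (D, insert d X)) ` (D - X). hits t N D' V"
  proof (rule common_hits)
    show "finite ((\<lambda>d. (D, insert d X)) ` (D - X))" using finite_subset[OF DA fin] by simp
  next
    fix D' V assume "(D', V) \<in> (\<lambda>d. (D, insert d X)) ` (D - X)"
    then obtain d where d: "d \<in> D" "d \<notin> X" "D' = D" "V = insert d X" by auto
    then have "\<not> P V" using max[of V] by auto
    then show "D' \<subseteq> A \<and> D' \<inter> B \<noteq> {} \<and> (\<exists>N\<ge>1. \<exists>t \<in> term_ops F N. hits t N D' V)"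
      using d XD yX DA D(2) by (auto simp: P_def)
  qed
  then obtain N t where N: "N \<ge> 1" and t: "t \<in> term_ops F N"
    and th: "\<And>d. d \<in> D \<Longrightarrow> d \<notin> X \<Longrightarrow> hits t N D (insert d X)" by auto
  have key: "\<exists>k<m. \<forall>e. (\<forall>i<m. e i \<in> D) \<longrightarrow> e k \<in> X \<longrightarrow> s (map e [0..<m]) \<in> X"
    if m: "m \<ge> 1" and s: "s \<in> term_ops F m" for m s
  proof (rule ccontr)
    assume "\<not> ?thesis"
    then obtain E where E: "\<And>k. k < m \<Longrightarrow> (\<forall>i<m. E k i \<in> D) \<and> E k k \<in> X \<and> s (map (E k) [0..<m]) \<notin> X"
      by metis
    have "hits (star N m t s) (N * m) D X"
      unfolding hits_def
    proof (intro allI impI)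
      fix l assume l: "l < N * m"
      define j k where "j = l div m" and "k = l mod m"
      have k: "k < m" and j: "j < N" using m l by (auto simp: j_def k_def less_mult_imp_div_less)
      define d where "d = s (map (E k) [0..<m])"
      have d: "d \<in> D" "d \<notin> X" using E[OF k] closed_underD[OF clD s] by (auto simp: d_def)
      obtain e where e: "\<forall>i<N. e i \<in> D" "e j \<in> insert d X" "t (map e [0..<N]) \<in> B"
        using th[OF d] j unfolding hits_def by blast
      \<comment> \<open>If the witness for \<open>t\<close> uses the added point \<open>d\<close> at
        place \<open>j\<close>, that block is replaced by \<open>E k\<close>, whose
        \<open>s\<close>-value is \<open>d\<close> and whose entry \<open>k\<close> lies in
        \<open>X\<close>. Thus \<open>star N m t s\<close> would hit \<open>X\<close>
        itself.\<close>
      define e' where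
        "e' i = (if i div m = j \<and> e j = d then E k (i mod m) else e (i div m))" for i
      have "s (map (\<lambda>q. e' (i * m + q)) [0..<m]) = e i" if i: "i < N" for i
      proof (cases "i = j \<and> e j = d")
        case True
        then have "map (\<lambda>q. e' (i * m + q)) [0..<m] = map (E k) [0..<m]" by (auto simp: e'_def)
        then show ?thesis using True d_def by metis
      next
        case False
        then show ?thesis using e i DA by (intro term_const[OF s]) (auto simp: e'_def)
      qed
      then have "map (\<lambda>i. s (map (\<lambda>q. e' (i * m + q)) [0..<m])) [0..<N] = map e [0..<N]" by simp
      then have "star N m t s (map e' [0..<N * m]) \<in> B" using e(3) unfolding star_eval by metis
      moreover have "\<forall>i<N * m. e' i \<in> D" using e(1) E[OF k] m
        by (auto simp: e'_def less_mult_imp_div_less)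
      moreover have "e' l \<in> X" using e(2) E[OF k] by (auto simp: e'_def j_def k_def)
      ultimately show "\<exists>e. (\<forall>i<N * m. e i \<in> D) \<and> e l \<in> X \<and> star N m t s (map e [0..<N * m]) \<in> B"
        by blast
    qed
    moreover have "N * m \<ge> 1" using N m by simp
    ultimately show False using noX[OF _ star_term[OF t s]] by blast
  qed
  have "blocker A F B X D"
    unfolding blocker_def
  proof (intro conjI allI impI D XD XB)
    show "X \<noteq> {}" using yX by auto
    fix n :: nat assume n: "n \<ge> 1"
    show "subuniverse_pow A F n (tuples n D - tuples n (D - X))"
      unfolding subuniverse_pow_def
    proof (intro conjI ballI, goal_cases)
      case 1
      show ?case using DA by (auto simp: tuples_def)
    next
      case (2 mf)
      obtain m f where mf: "mf = (m, f)" and f: "(m, f) \<in> F" using 2 by (cases mf) auto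
      have "map (\<lambda>i. f (map (\<lambda>t. t ! i) ts)) [0..<n] \<in> tuples n D - tuples n (D - X)"
        if ts: "length ts = m" "set ts \<subseteq> tuples n D - tuples n (D - X)" for ts
      proof (cases "m = 0")
        \<comment> \<open>\<open>key\<close> speaks of positive arities only; idempotence forces a
          nullary operation to have the value \<open>y\<close>.\<close>
        case True
        have "\<forall>x\<in>A. f (replicate m x) = x" using idem f by (auto simp: idempotent_alg_def)
        then have "f [] = y" using True y DA by auto
        then show ?thesis using True ts n y yX
          by (auto simp: tuples_def image_subset_iff Ball_def intro!: exI[of _ 0])
      next
        case False
        define s where "s = (\<lambda>xs. f (map (\<lambda>j. xs ! j) [0..<m]))"
        obtain k where k: "k < m"
          and sk: "\<And>e. (\<forall>i<m. e i \<in> D) \<Longrightarrow> e k \<in> X \<Longrightarrow> s (map e [0..<m]) \<in> X"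
          using key[of m s] basic_term[OF f] False unfolding s_def by auto
        have tsD: "ts ! j ! i \<in> D" if "j < m" "i < n" for i j
        proof -
          have "ts ! j \<in> tuples n D" using ts that by (metis DiffD1 nth_mem subsetD)
          then show ?thesis using that by (auto simp: tuples_def)
        qed
        have eq: "f (map (\<lambda>t. t ! i) ts) = s (map (\<lambda>j. ts ! j ! i) [0..<m])" for i
          unfolding s_def using ts(1) by (intro arg_cong[where f=f] nth_equalityI) auto
        have "s (map (\<lambda>j. ts ! j ! i) [0..<m]) \<in> D" if "i < n" for i
          using closed_underD[OF clD basic_term[OF f], of "\<lambda>j. ts ! j ! i"] tsD that
          unfolding s_def by simp
        then have inD: "map (\<lambda>i. f (map (\<lambda>t. t ! i) ts)) [0..<n] \<in> tuples n D"
          using eq by (auto simp: tuples_def)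
        have "ts ! k \<in> tuples n D - tuples n (D - X)" using ts k by (metis nth_mem subsetD)
        then obtain i where i: "i < n" "ts ! k ! i \<in> X"
          by (auto simp: tuples_def in_set_conv_nth)
        then have "f (map (\<lambda>t. t ! i) ts) \<in> X" using sk[of "\<lambda>j. ts ! j ! i"] tsD eq by simp
        then have "map (\<lambda>i. f (map (\<lambda>t. t ! i) ts)) [0..<n] \<notin> tuples n (D - X)"
          using i by (auto simp: tuples_def image_subset_iff)
        then show ?thesis using inD by blast
      qed
      then show ?case by (auto simp: mf)
    qed
  qed
  then show False using nb by blast
qed

lemma no_blocker_uniform_hits:
  assumes nb: "\<not> (\<exists>C D. blocker A F B C D)"
  obtains N t where "N \<ge> 1" "t \<in> term_ops F N"
    "\<And>D y. closed_under F D \<Longrightarrow> D \<subseteq> A \<Longrightarrow> D \<inter> B \<noteq> {} \<Longrightarrow> y \<in> D \<Longrightarrow> hits t N D {y}"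
proof -
  let ?Q = "{(D, V). closed_under F D \<and> D \<subseteq> A \<and> D \<inter> B \<noteq> {} \<and> (\<exists>y \<in> D. V = {y})}"
  have "?Q \<subseteq> Pow A \<times> Pow A" by auto
  then have "finite ?Q" by (rule finite_subset) (simp add: fin)
  then have "\<exists>N\<ge>1. \<exists>t \<in> term_ops F N. \<forall>(D, V) \<in> ?Q. hits t N D V"
    by (rule common_hits) (use no_blocker_imp_hits[OF nb] closed_subuniverse in blast)
  then show thesis using that by fastforce
qed

end

section \<open>A bad triple from Ramsey's theorem\<close>

text \<open>Row \<open>i\<close> of a matrix with \<open>\<xi>\<close> on the diagonal,
  \<open>\<beta>\<close> below and \<open>\<alpha>\<close> above it. Terms act down the columns
  \<open>l\<close>.\<close>

definition row :: "'a \<Rightarrow> 'a \<Rightarrow> 'a \<Rightarrow> nat \<Rightarrow> nat \<Rightarrow> 'a" where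
  "row \<beta> \<xi> \<alpha> i l = (if l < i then \<beta> else if l = i then \<xi> else \<alpha>)"

context idempotent_pair
begin

text \<open>By minimality of \<open>Y\<close>, each test tuple \<open>y\<close> is the only one that a suitable term fails to map
  into \<open>B\<close>; these terms become the rows of a \<open>B\<close>-essential relation with columns \<open>Y\<close>.\<close>

lemma not_absorbs_minimal_test_set:
  assumes na: "\<not> absorbs A F B"
  obtains Y where "Y \<subseteq> {as. length as = n \<and> set as \<subseteq> A \<and> card {i. i < n \<and> as ! i \<notin> B} \<le> 1}"
    "\<And>t. t \<in> term_ops F n \<Longrightarrow> \<exists>y\<in>Y. t y \<notin> B"
    "\<And>y. y \<in> Y \<Longrightarrow> \<exists>t\<in>term_ops F n. \<forall>y'\<in>Y - {y}. t y' \<in> B"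
proof -
  let ?X = "{as. length as = n \<and> set as \<subseteq> A \<and> card {i. i < n \<and> as ! i \<notin> B} \<le> 1}"
  define Q where "Q Y \<longleftrightarrow> Y \<subseteq> ?X \<and> (\<forall>t \<in> term_ops F n. \<exists>y\<in>Y. t y \<notin> B)" for Y
  have "\<exists>y\<in>?X. t y \<notin> B" if t: "t \<in> term_ops F n" for t
  proof (rule ccontr)
    assume c: "\<not> ?thesis"
    have "t (replicate n x) = x" if "x \<in> A" for x
      using term_idem[OF t that] by (simp add: map_replicate_const)
    then have "absorbs A F B" using t c unfolding absorbs_def by blast
    then show False using na by simp
  qed
  then have Q: "Q ?X" by (simp add: Q_def)
  moreover have "finite {Y. Q Y}"
  proof (rule finite_subset)
    show "{Y. Q Y} \<subseteq> Pow {as. set as \<subseteq> A \<and> length as = n}" by (auto simp: Q_def)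
    show "finite (Pow {as. set as \<subseteq> A \<and> length as = n})"
      using finite_lists_length_eq[OF fin] by simp
  qed
  ultimately obtain Y where Y: "Q Y" and min: "\<And>Y'. Q Y' \<Longrightarrow> Y' \<subseteq> Y \<Longrightarrow> Y' = Y"
    using finite_has_minimal[of "{Y. Q Y}"] by auto
  show thesis
  proof (rule that[of Y])
    fix y assume y: "y \<in> Y"
    then have "\<not> Q (Y - {y})" using min[of "Y - {y}"] by auto
    then show "\<exists>t\<in>term_ops F n. \<forall>y'\<in>Y - {y}. t y' \<in> B" using Y by (auto simp: Q_def)
  qed (use Y in \<open>auto simp: Q_def\<close>)
qed

lemma good_pad:
  assumes t: "t \<in> term_ops F N" and g: "\<And>l. l < N \<Longrightarrow> t (map (\<lambda>i. row b a b' i l) [0..<N]) \<in> B"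
    and b': "b' \<in> B" and "N \<le> K"
  shows "\<exists>t\<in>term_ops F K. \<forall>l<K. t (map (\<lambda>i. row b a b' i l) [0..<K]) \<in> B"
proof
  let ?s = "\<lambda>xs. t (map (\<lambda>i. xs ! i) [0..<N])"
  show "?s \<in> term_ops F K" using term_reindex[OF t, of "\<lambda>i. i" K] assms by simp
  have "?s (map (\<lambda>i. row b a b' i l) [0..<K]) = t (map (\<lambda>i. row b a b' i l) [0..<N])" for l
    using \<open>N \<le> K\<close> by (intro arg_cong[where f=t] map_cong) auto
  moreover have "t (map (\<lambda>i. row b a b' i l) [0..<N]) \<in> B" for l
  proof (cases "l < N")
    case False
    then have "t (map (\<lambda>i. row b a b' i l) [0..<N]) = b'"
      using b' BA by (intro term_const[OF t]) (auto simp: row_def)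
    then show ?thesis using b' by simp
  qed (rule g)
  ultimately show "\<forall>l<K. ?s (map (\<lambda>i. row b a b' i l) [0..<K]) \<in> B" by simp
qed

text \<open>If each triple had a term sending its columns into \<open>B\<close>, dummy variables
  would give all these terms a common arity \<open>K\<close>. Ramsey's theorem finds a submatrix of
  shape \<open>row\<close> among the values \<open>u i l\<close> of the essential terms at the
  tests. The term for its triple, applied to the selected \<open>T (h i)\<close>, would map all of
  \<open>Y\<close> into \<open>B\<close>.\<close>

lemma not_absorbs_bad_triple:
  assumes na: "\<not> absorbs A F B"
  obtains a b b' where "a \<in> A" "b \<in> B" "b' \<in> B"
    "\<And>N t. t \<in> term_ops F N \<Longrightarrow> \<exists>l<N. t (map (\<lambda>i. row b a b' i l) [0..<N]) \<notin> B"
proof (rule ccontr)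
  assume neg: "\<not> thesis"
  note witness = that
  define C where "C = B \<times> B \<times> A"
  have finC: "finite C" using finite_subset[OF BA fin] fin by (simp add: C_def)
  have tri: "\<exists>N. \<exists>t\<in>term_ops F N. \<forall>l<N. t (map (\<lambda>i. row b a b' i l) [0..<N]) \<in> B"
    if abb: "a \<in> A" "b \<in> B" "b' \<in> B" for a b b'
  proof (rule ccontr)
    assume "\<not> ?thesis"
    then have thesis using witness[OF abb] by blast
    then show False using neg by simp
  qed
  have "\<forall>c\<in>C. \<exists>N. \<exists>t\<in>term_ops F N. \<forall>l<N. t (map (\<lambda>i. row (fst (snd c)) (snd (snd c)) (fst c) i l) [0..<N]) \<in> B"
    using tri by (simp add: C_def)
  then obtain n0 where n0: "\<And>c. c \<in> C \<Longrightarrow> \<exists>t\<in>term_ops F (n0 c). \<forall>l<n0 c.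
      t (map (\<lambda>i. row (fst (snd c)) (snd (snd c)) (fst c) i l) [0..<n0 c]) \<in> B" by metis
  define K where "K = Max (insert 0 (n0 ` C))"
  have K: "n0 c \<le> K" if "c \<in> C" for c using that finC by (auto simp: K_def)
  have good: "\<exists>t\<in>term_ops F K. \<forall>l<K. t (map (\<lambda>i. row b a b' i l) [0..<K]) \<in> B"
    if "a \<in> A" "b \<in> B" "b' \<in> B" for a b b'
  proof -
    have c: "(b', b, a) \<in> C" using that by (simp add: C_def)
    show ?thesis using n0[OF c] good_pad[OF _ _ that(3) K[OF c]] by auto
  qed
  obtain \<kappa> where \<kappa>: "bij_betw \<kappa> C {0..<card C}" using ex_bij_betw_finite_nat[OF finC] by blast
  \<comment> \<open>The colour of a pair includes the diagonal entry of its smaller index only. So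
    \<open>K\<close> usable columns need one further, larger index.\<close>
  obtain n :: nat where n: "partn_lst {..<n} (replicate (card C) (Suc K)) 2"
    using ramsey_full[where qs = "replicate (card C) (Suc K)" and r = 2] by blast
  obtain Y where Y: "Y \<subseteq> {as. length as = n \<and> set as \<subseteq> A \<and> card {i. i < n \<and> as ! i \<notin> B} \<le> 1}"
    and hit: "\<And>t. t \<in> term_ops F n \<Longrightarrow> \<exists>y\<in>Y. t y \<notin> B"
    and ex: "\<And>y. y \<in> Y \<Longrightarrow> \<exists>t\<in>term_ops F n. \<forall>y'\<in>Y - {y}. t y' \<in> B"
    by (rule not_absorbs_minimal_test_set[OF na, of n]) blast
  \<comment> \<open>The projection to place \<open>i\<close> must fail at some test. Entry
    \<open>i\<close> is then the only entry of that test outside \<open>B\<close>, so the tests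
    \<open>y i\<close> are distinct.\<close>
  have "\<forall>i<n. \<exists>y\<in>Y. y ! i \<notin> B" using hit term_ops.proj[of _ n F] by blast
  then obtain y where y: "\<And>i. i < n \<Longrightarrow> y i \<in> Y \<and> y i ! i \<notin> B" by metis
  have inj: "y i \<noteq> y l" if "i < n" "l < n" "i \<noteq> l" for i l
  proof
    assume e: "y i = y l"
    have "{i, l} \<subseteq> {k. k < n \<and> y i ! k \<notin> B}" using y[OF that(1)] y[OF that(2)] e that by auto
    then have "card {i, l} \<le> card {k. k < n \<and> y i ! k \<notin> B}" by (intro card_mono) auto
    moreover have "card {k. k < n \<and> y i ! k \<notin> B} \<le> 1" using Y y[OF that(1)] by auto
    ultimately show False using that(3) by simp
  qed
  have "\<forall>i<n. \<exists>t. t \<in> term_ops F n \<and> (\<forall>y'\<in>Y - {y i}. t y' \<in> B)"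
    using ex y by fast
  then obtain T where T: "\<And>i. i < n \<Longrightarrow> T i \<in> term_ops F n \<and> (\<forall>y'\<in>Y - {y i}. T i y' \<in> B)"
    by metis
  define u where "u i l = T i (y l)" for i l
  have uA: "u i l \<in> A" if "i < n" "l < n" for i l
  proof -
    have "y l \<in> Y" "T i \<in> term_ops F n" using y T that by auto
    moreover have "length (y l) = n" "set (y l) \<subseteq> A" using Y \<open>y l \<in> Y\<close> by auto
    ultimately show ?thesis
      using closed_underD[OF closed_A, of "T i" n "\<lambda>k. y l ! k"] unfolding u_def
      by (metis map_nth nth_mem subsetD)
  qed
  have uB: "u i l \<in> B" if "i < n" "l < n" "i \<noteq> l" for i l
    using T[OF that(1)] y[OF that(2)] inj[OF that] unfolding u_def by auto
  define \<phi> where "\<phi> e = \<kappa> (u (Min e) (Max e), u (Max e) (Min e), u (Min e) (Min e))" for e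
  have pair: "Min {i, l} = i" "Max {i, l} = l" if "i < l" for i l :: nat
    using that by auto
  have \<phi>: "\<phi> {i, l} = \<kappa> (u i l, u l i, u i i)" if "i < l" for i l
    unfolding \<phi>_def pair[OF that] ..
  have uC: "(u i l, u l i, u i i) \<in> C" if "i < l" "l < n" for i l
    using that uA uB by (auto simp: C_def)
  have "\<phi> \<in> nsets {..<n} 2 \<rightarrow> {..<card C}"
  proof
    fix e assume "e \<in> [{..<n}]\<^bsup>2\<^esup>"
    then obtain i l where e: "e = {i, l}" "i < l" "l < n" by (auto simp: ordered_nsets_2_eq)
    then show "\<phi> e \<in> {..<card C}"
      using uC[OF e(2,3)] \<phi>[OF e(2)] bij_betwE[OF \<kappa>] by fastforce
  qed
  then obtain q H where q: "q < card C" and H: "H \<in> nsets {..<n} (Suc K)"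
    and mono: "\<phi> ` nsets H 2 \<subseteq> {q}"
    by (rule partn_lstE[OF n]) auto
  have Hn: "H \<subseteq> {..<n}" "finite H" "card H = Suc K" using H by (auto simp: nsets_def)
  have "q \<in> \<kappa> ` C" using q bij_betw_imp_surj_on[OF \<kappa>] by simp
  then obtain c where c: "c \<in> C" "\<kappa> c = q" by blast
  obtain b' b a where bba: "c = (b', b, a)" "b' \<in> B" "b \<in> B" "a \<in> A" using c by (auto simp: C_def)
  have col: "u i l = b' \<and> u l i = b \<and> u i i = a" if "i \<in> H" "l \<in> H" "i < l" for i l
  proof -
    have "{i, l} \<in> nsets H 2" using that by auto
    then have "\<phi> {i, l} = q" using mono by blast
    then have "\<kappa> (u i l, u l i, u i i) = \<kappa> c" using \<phi> that c by simp
    moreover have "l < n" using that Hn by auto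
    ultimately have "(u i l, u l i, u i i) = c"
      using bij_betw_imp_inj_on[OF \<kappa>] uC[OF that(3)] c(1) by (auto dest: inj_onD)
    then show ?thesis using bba by simp
  qed
  define h where "h s = sorted_list_of_set H ! s" for s
  have hH: "h s \<in> H" if "s \<le> K" for s
    using that Hn nth_mem[of s "sorted_list_of_set H"] by (simp add: h_def)
  have hmono: "h s < h r" if "s < r" "r \<le> K" for s r
    using that Hn sorted_wrt_nth_less[OF strict_sorted_list_of_set[of H], of s r] by (simp add: h_def)
  have hn: "h s < n" if "s \<le> K" for s using hH[OF that] Hn by auto
  obtain M where M: "M \<in> term_ops F K" "\<And>l. l < K \<Longrightarrow> M (map (\<lambda>i. row b a b' i l) [0..<K]) \<in> B"
    using good bba by metis
  let ?t = "\<lambda>xs. M (map (\<lambda>i. T (h i) xs) [0..<K])"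
  have t: "?t \<in> term_ops F n" using T hn by (intro term_subst[OF M(1)]) auto
  have "?t y' \<in> B" if y': "y' \<in> Y" for y'
  proof (cases "\<exists>l<K. y' = y (h l)")
    case True
    then obtain l where l: "l < K" "y' = y (h l)" by blast
    have "T (h i) y' = row b a b' i l" if "i < K" for i
      using col[OF hH hH hmono, of i l] col[OF hH hH hmono, of l i] col[OF hH hH hmono, of l K] that l
      by (auto simp: u_def row_def not_less_iff_gr_or_eq)
    then have "map (\<lambda>i. T (h i) y') [0..<K] = map (\<lambda>i. row b a b' i l) [0..<K]" by simp
    then show ?thesis using M(2)[OF l(1)] by metis
  next
    case False
    then show ?thesis using T hn y' by (intro closed_underD[OF closed_B M(1)]) auto
  qed
  then show False using hit[OF t] by blast
qed

end

section \<open>Relations with hub coordinates\<close>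

definition box :: "(nat \<Rightarrow> 'a set) \<Rightarrow> nat \<Rightarrow> 'a \<Rightarrow> (nat \<Rightarrow> 'a) set" where
  "box D h \<alpha> = {p. (\<forall>c<h. p c \<in> D c) \<and> (\<forall>c\<ge>h. p c = \<alpha>)}"

text \<open>The order of the quantifiers reflects later choices: \<open>L\<close> comes from
  \<open>not_endable_bound\<close> and depends on \<open>\<sigma>\<close>, while
  \<open>\<rho>\<close> must reach the constant tail of a sequence that was itself chosen for
  \<open>\<sigma>\<close> and \<open>L\<close>.\<close>

definition eventually_pads :: "(nat \<Rightarrow> nat \<Rightarrow> nat \<Rightarrow> bool) \<Rightarrow> bool" where
  "eventually_pads Q \<longleftrightarrow> (\<forall>\<^sub>F \<sigma> in sequentially. \<forall>L. \<forall>\<^sub>F \<rho> in sequentially. Q \<sigma> L \<rho>)"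

lemma eventually_pads_conj:
  assumes "eventually_pads P" "eventually_pads Q"
  shows "eventually_pads (\<lambda>\<sigma> L \<rho>. P \<sigma> L \<rho> \<and> Q \<sigma> L \<rho>)"
  using assms unfolding eventually_pads_def
  by eventually_elim (auto intro: eventually_conj)

lemma eventually_pads_mono:
  assumes "eventually_pads P" "\<And>\<sigma> L \<rho>. P \<sigma> L \<rho> \<Longrightarrow> Q \<sigma> L \<rho>"
  shows "eventually_pads Q"
  using assms(1) unfolding eventually_pads_def
proof (rule eventually_mono, intro allI)
  fix \<sigma> L assume "\<forall>L. \<forall>\<^sub>F \<rho> in sequentially. P \<sigma> L \<rho>"
  then have "\<forall>\<^sub>F \<rho> in sequentially. P \<sigma> L \<rho>" ..
  then show "\<forall>\<^sub>F \<rho> in sequentially. Q \<sigma> L \<rho>" by (rule eventually_mono) (rule assms(2))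
qed

lemma eventually_pads_ball:
  assumes "finite S" "\<And>s. s \<in> S \<Longrightarrow> eventually_pads (Q s)"
  shows "eventually_pads (\<lambda>\<sigma> L \<rho>. \<forall>s\<in>S. Q s \<sigma> L \<rho>)"
  using assms
proof (induction rule: finite_induct)
  case empty
  show ?case by (simp add: eventually_pads_def)
next
  case (insert s S)
  have "eventually_pads (\<lambda>\<sigma> L \<rho>. Q s \<sigma> L \<rho> \<and> (\<forall>s\<in>S. Q s \<sigma> L \<rho>))"
    using insert by (intro eventually_pads_conj) auto
  then show ?case by (rule eventually_pads_mono) auto
qed

context idempotent_pair
begin

definition closed_rel :: "((nat \<Rightarrow> 'a) \<times> (nat \<Rightarrow> 'a)) set \<Rightarrow> bool" where
  "closed_rel R \<longleftrightarrow> (\<forall>n. \<forall>t \<in> term_ops F n. \<forall>z p. (\<forall>j<n. (z j, p j) \<in> R) \<longrightarrow>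
     (\<lambda>l. t (map (\<lambda>j. z j l) [0..<n]), \<lambda>c. t (map (\<lambda>j. p j c) [0..<n])) \<in> R)"

lemma closed_relD:
  assumes "closed_rel R" "t \<in> term_ops F n" "\<And>j. j < n \<Longrightarrow> (z j, p j) \<in> R"
  shows "(\<lambda>l. t (map (\<lambda>j. z j l) [0..<n]), \<lambda>c. t (map (\<lambda>j. p j c) [0..<n])) \<in> R"
  using assms unfolding closed_rel_def by blast

lemma term_upd:
  assumes "t \<in> term_ops F n" "\<And>c. p c \<in> A"
  shows "(\<lambda>c. t (map (\<lambda>j. (p(k := q j)) c) [0..<n])) = p(k := t (map q [0..<n]))"
  using term_idem[OF assms(1,2)] by auto

definition sg :: "'a set \<Rightarrow> 'a set" where
  "sg X = \<Inter>{S. closed_under F S \<and> X \<subseteq> S \<and> S \<subseteq> A}"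

lemma sg_closed: "closed_under F (sg X)"
  unfolding closed_under_def sg_def by auto

lemma sg_sub: "X \<subseteq> sg X"
  by (auto simp: sg_def)

lemma sg_least: "closed_under F S \<Longrightarrow> X \<subseteq> S \<Longrightarrow> S \<subseteq> A \<Longrightarrow> sg X \<subseteq> S"
  by (auto simp: sg_def)

end

text \<open>An element \<open>(z, p)\<close> of \<open>R\<close> consists of a sequence \<open>z\<close> and of a hub tuple \<open>p\<close>, which is padded by
  the constant \<open>\<alpha>\<close> from index \<open>h\<close> on. A box element through some \<open>y c\<close> extends to sequences over \<open>B\<close>
  that start with arbitrarily many \<open>\<beta>\<close> (\<open>steps\<close>), and a box element over \<open>B\<close> never extends to a
  sequence over \<open>B\<close> (\<open>bad\<close>).\<close>

locale stage = idempotent_pair +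
  fixes R :: "((nat \<Rightarrow> 'a) \<times> (nat \<Rightarrow> 'a)) set" and D :: "nat \<Rightarrow> 'a set" and y :: "nat \<Rightarrow> 'a"
    and \<alpha> \<beta> \<xi> :: 'a and h :: nat
  assumes closed_R: "closed_rel R"
    and R_ev: "(z, p) \<in> R \<Longrightarrow> \<exists>M. \<forall>l\<ge>M. z l = \<alpha>"
    and R_out: "(z, p) \<in> R \<Longrightarrow> c \<ge> h \<Longrightarrow> p c = \<alpha>"
    and \<alpha>B: "\<alpha> \<in> B" and \<beta>B: "\<beta> \<in> B" and \<xi>A: "\<xi> \<in> A"
    and D_closed: "c < h \<Longrightarrow> closed_under F (D c)" and D_A: "c < h \<Longrightarrow> D c \<subseteq> A"
    and y_D: "c < h \<Longrightarrow> y c \<in> D c" and D_B: "c < h \<Longrightarrow> D c \<inter> B \<noteq> {}"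
    and rows: "p \<in> box D h \<alpha> \<Longrightarrow> (row \<beta> \<xi> \<alpha> i, p) \<in> R"
    and steps: "p \<in> box D h \<alpha> \<Longrightarrow> c < h \<Longrightarrow> p c = y c \<Longrightarrow>
      \<exists>z. (z, p) \<in> R \<and> (\<forall>l. z l \<in> B) \<and> (\<forall>l<L. z l = \<beta>)"
    and bad: "(z, p) \<in> R \<Longrightarrow> p \<in> box D h \<alpha> \<Longrightarrow> (\<And>c. c < h \<Longrightarrow> p c \<in> B) \<Longrightarrow> \<exists>l. z l \<notin> B"
begin

abbreviation "P \<equiv> box D h \<alpha>"
abbreviation "PX \<equiv> {p \<in> P. \<exists>c<h. p c = y c}"

lemma bases_in_A [simp]: "\<alpha> \<in> A" "\<beta> \<in> A"
  using \<alpha>B \<beta>B BA by auto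

lemma box_A: "p \<in> P \<Longrightarrow> p c \<in> A"
  using D_A by (cases "c < h") (auto simp: box_def)

lemma finite_box: "finite P"
proof -
  have "P \<subseteq> {f. \<forall>x. (x \<in> {..<h} \<longrightarrow> f x \<in> A) \<and> (x \<notin> {..<h} \<longrightarrow> f x = \<alpha>)}"
    using D_A by (auto simp: box_def)
  then show ?thesis
    by (rule finite_subset) (rule finite_set_of_finite_funs[OF _ fin], simp)
qed

lemma box_B_ex: "\<exists>\<tau>\<in>P. \<forall>c<h. \<tau> c \<in> B"
proof -
  have "\<forall>c. \<exists>x. c < h \<longrightarrow> x \<in> D c \<inter> B" using D_B by blast
  then obtain f where "\<And>c. c < h \<Longrightarrow> f c \<in> D c \<inter> B" by metis
  then show ?thesis by (intro bexI[of _ "\<lambda>c. if c < h then f c else \<alpha>"]) (auto simp: box_def)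
qed

lemma closed3:
  assumes d: "d \<in> term_ops F 3" and p: "p \<in> P" and z: "(z1, p) \<in> R" "(z2, p) \<in> R" "(z3, p) \<in> R"
  shows "(\<lambda>l. d [z1 l, z2 l, z3 l], p) \<in> R"
proof -
  have "(\<lambda>l. d (map (\<lambda>j. ([z1, z2, z3] ! j) l) [0..<3]), \<lambda>c. d (map (\<lambda>j. p c) [0..<3])) \<in> R"
  proof (rule closed_relD[OF closed_R d])
    fix j :: nat assume "j < 3"
    then have "j = 0 \<or> j = 1 \<or> j = 2" by auto
    then show "([z1, z2, z3] ! j, \<lambda>c. p c) \<in> R" using z by auto
  qed
  then show ?thesis using term_idem[OF d box_A[OF p]] by (simp add: numeral_3_eq_3)
qed

text \<open>The next hub is cut off at the front of the sequences: entry \<open>0\<close> is \<open>v\<close>, then come \<open>\<sigma>\<close> spare entries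
  in \<open>B\<close>, a block of \<open>L\<close> entries \<open>g\<close>, \<open>\<rho>\<close> more spare entries in \<open>B\<close>, and the remaining sequence \<open>w\<close>.
  The pair \<open>(g, v)\<close> acts as a node of the graph \<open>link\<close> below; the spare entries are where the
  Jonsson terms can be applied with an element outside \<open>B\<close> in the middle.\<close>

definition is_padded :: "(nat \<Rightarrow> 'a) \<Rightarrow> 'a \<Rightarrow> nat \<Rightarrow> 'a \<Rightarrow> nat \<Rightarrow> nat \<Rightarrow> (nat \<Rightarrow> 'a) \<Rightarrow> (nat \<Rightarrow> 'a) \<Rightarrow> bool" where
  "is_padded p v \<sigma> g L \<rho> w z \<longleftrightarrow> (z, p) \<in> R \<and> z 0 = v \<and> (\<forall>l. 1 \<le> l \<and> l \<le> \<sigma> \<longrightarrow> z l \<in> B) \<and>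
     (\<forall>l. \<sigma> < l \<and> l \<le> \<sigma> + L \<longrightarrow> z l = g) \<and>
     (\<forall>l. \<sigma> + L < l \<and> l \<le> \<sigma> + L + \<rho> \<longrightarrow> z l \<in> B) \<and>
     (\<forall>l. z (l + (\<sigma> + L + \<rho> + 1)) = w l)"

definition padded :: "(nat \<Rightarrow> 'a) \<Rightarrow> 'a \<Rightarrow> nat \<Rightarrow> 'a \<Rightarrow> nat \<Rightarrow> nat \<Rightarrow> (nat \<Rightarrow> 'a) \<Rightarrow> bool" where
  "padded p v \<sigma> g L \<rho> w \<longleftrightarrow> (\<exists>z. is_padded p v \<sigma> g L \<rho> w z)"

section \<open>Padded sequences, links and walks as relations closed under terms\<close>

lemma padded_closed:
  assumes t: "t \<in> term_ops F m" and r: "\<And>j. j < m \<Longrightarrow> padded (p j) (v j) \<sigma> (g j) L \<rho> (w j)"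
  shows "padded (\<lambda>c. t (map (\<lambda>j. p j c) [0..<m])) (t (map v [0..<m])) \<sigma> (t (map g [0..<m])) L \<rho>
    (\<lambda>l. t (map (\<lambda>j. w j l) [0..<m]))"
proof -
  obtain z where z: "\<And>j. j < m \<Longrightarrow> is_padded (p j) (v j) \<sigma> (g j) L \<rho> (w j) (z j)"
    using r unfolding padded_def by metis
  have cong: "t (map e [0..<m]) = t (map e' [0..<m])" if "\<And>j. j < m \<Longrightarrow> e j = e' j" for e e'
    using that by (intro arg_cong[where f=t]) auto
  show ?thesis unfolding padded_def is_padded_def
    by (intro exI[of _ "\<lambda>l. t (map (\<lambda>j. z j l) [0..<m])"] conjI closed_relD[OF closed_R t] allI impI
        closed_underD[OF closed_B t] cong) (use z in \<open>auto simp: is_padded_def\<close>)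
qed

lemma padded_closed_box:
  assumes t: "t \<in> term_ops F m" and p: "p \<in> P" and r: "\<And>j. j < m \<Longrightarrow> padded p (v j) \<sigma> (g j) L \<rho> (w j)"
  shows "padded p (t (map v [0..<m])) \<sigma> (t (map g [0..<m])) L \<rho> (\<lambda>l. t (map (\<lambda>j. w j l) [0..<m]))"
  using padded_closed[OF t, of "\<lambda>_. p" v \<sigma> g L \<rho> w] r term_idem[OF t box_A[OF p]] by simp

text \<open>The block value \<open>g\<close> and the base \<open>\<gamma>\<close> of the remaining
  rows are separate parameters because the two nodes of a link must leave the same rows
  behind.\<close>

definition pads_rows :: "'a \<Rightarrow> 'a \<Rightarrow> 'a \<Rightarrow> 'a \<Rightarrow> bool" where
  "pads_rows g v \<xi>' \<gamma> \<longleftrightarrow> eventually_pads (\<lambda>\<sigma> L \<rho>. \<forall>p\<in>P. \<forall>i. padded p v \<sigma> g L \<rho> (row \<gamma> \<xi>' \<alpha> i))"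

definition pads_steps :: "'a \<Rightarrow> 'a \<Rightarrow> 'a \<Rightarrow> bool" where
  "pads_steps g v \<gamma> \<longleftrightarrow> eventually_pads (\<lambda>\<sigma> L \<rho>. \<forall>p\<in>PX. \<forall>K. \<exists>w. padded p v \<sigma> g L \<rho> w \<and> (\<forall>l. w l \<in> B) \<and> (\<forall>l<K. w l = \<gamma>))"

lemma row_closed:
  assumes t: "t \<in> term_ops F m"
  shows "(\<lambda>l. t (map (\<lambda>j. row (\<gamma> j) (\<zeta> j) \<alpha> i l) [0..<m])) = row (t (map \<gamma> [0..<m])) (t (map \<zeta> [0..<m])) \<alpha> i"
proof
  fix l
  show "t (map (\<lambda>j. row (\<gamma> j) (\<zeta> j) \<alpha> i l) [0..<m]) = row (t (map \<gamma> [0..<m])) (t (map \<zeta> [0..<m])) \<alpha> i l"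
    using term_idem[OF t, of \<alpha>] by (simp add: row_def)
qed

lemma pads_rows_closed:
  assumes t: "t \<in> term_ops F m" and s: "\<And>j. j < m \<Longrightarrow> pads_rows (g j) (v j) (\<zeta> j) (\<gamma> j)"
  shows "pads_rows (t (map g [0..<m])) (t (map v [0..<m])) (t (map \<zeta> [0..<m])) (t (map \<gamma> [0..<m]))"
proof -
  have "eventually_pads (\<lambda>\<sigma> L \<rho>. \<forall>j\<in>{..<m}. \<forall>p\<in>P. \<forall>i. padded p (v j) \<sigma> (g j) L \<rho> (row (\<gamma> j) (\<zeta> j) \<alpha> i))"
    using s unfolding pads_rows_def by (rule eventually_pads_ball[OF finite_lessThan]) auto
  then show ?thesis unfolding pads_rows_def
  proof (rule eventually_pads_mono, intro ballI allI)
    fix \<sigma> L \<rho> p i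
    assume a: "\<forall>j\<in>{..<m}. \<forall>p\<in>P. \<forall>i. padded p (v j) \<sigma> (g j) L \<rho> (row (\<gamma> j) (\<zeta> j) \<alpha> i)" and p: "p \<in> P"
    show "padded p (t (map v [0..<m])) \<sigma> (t (map g [0..<m])) L \<rho>
        (row (t (map \<gamma> [0..<m])) (t (map \<zeta> [0..<m])) \<alpha> i)"
      unfolding row_closed[OF t, symmetric] using a p by (intro padded_closed_box t) auto
  qed
qed

lemma pads_steps_closed:
  assumes t: "t \<in> term_ops F m" and s: "\<And>j. j < m \<Longrightarrow> pads_steps (g j) (v j) (\<gamma> j)"
  shows "pads_steps (t (map g [0..<m])) (t (map v [0..<m])) (t (map \<gamma> [0..<m]))"
proof -
  have "eventually_pads (\<lambda>\<sigma> L \<rho>. \<forall>j\<in>{..<m}. \<forall>p\<in>PX. \<forall>K. \<exists>w. padded p (v j) \<sigma> (g j) L \<rho> w \<and> (\<forall>l. w l \<in> B) \<and> (\<forall>l<K. w l = \<gamma> j))"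
    using s unfolding pads_steps_def by (rule eventually_pads_ball[OF finite_lessThan]) auto
  then show ?thesis unfolding pads_steps_def
  proof (rule eventually_pads_mono, intro ballI allI)
    fix \<sigma> L \<rho> p K
    assume a: "\<forall>j\<in>{..<m}. \<forall>p\<in>PX. \<forall>K. \<exists>w. padded p (v j) \<sigma> (g j) L \<rho> w \<and> (\<forall>l. w l \<in> B) \<and> (\<forall>l<K. w l = \<gamma> j)"
      and p: "p \<in> PX"
    have "\<forall>j\<in>{..<m}. \<exists>w. padded p (v j) \<sigma> (g j) L \<rho> w \<and> (\<forall>l. w l \<in> B) \<and> (\<forall>l<K. w l = \<gamma> j)"
      using a p by blast
    from bchoice[OF this] obtain w where "\<forall>j\<in>{..<m}. padded p (v j) \<sigma> (g j) L \<rho> (w j) \<and> (\<forall>l. w j l \<in> B) \<and> (\<forall>l<K. w j l = \<gamma> j)"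
      by blast
    then have w: "\<And>j. j < m \<Longrightarrow> padded p (v j) \<sigma> (g j) L \<rho> (w j)"
      "\<And>j l. j < m \<Longrightarrow> w j l \<in> B" "\<And>j l. j < m \<Longrightarrow> l < K \<Longrightarrow> w j l = \<gamma> j"
      by auto
    have "t (map (\<lambda>j. w j l) [0..<m]) = t (map \<gamma> [0..<m])" if "l < K" for l
      using w(3) that by (intro arg_cong[where f=t]) auto
    then show "\<exists>w. padded p (t (map v [0..<m])) \<sigma> (t (map g [0..<m])) L \<rho> w \<and> (\<forall>l. w l \<in> B) \<and>
        (\<forall>l<K. w l = t (map \<gamma> [0..<m]))"
      using p w(1,2)
      by (intro exI[of _ "\<lambda>l. t (map (\<lambda>j. w j l) [0..<m])"] conjI padded_closed_box t allI
          closed_underD[OF closed_B t]) auto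
  qed
qed

text \<open>Linked nodes share all rows for one common \<open>\<zeta>\<close>, with the base \<open>g\<close> of the first node.\<close>

definition link :: "'a \<Rightarrow> 'a \<Rightarrow> 'a \<Rightarrow> 'a \<Rightarrow> bool" where
  "link g v g' v' \<longleftrightarrow> g \<in> B \<and> v \<in> A \<and> g' \<in> B \<and> v' \<in> A \<and>
     (\<exists>\<zeta>\<in>A. pads_rows g v \<zeta> g \<and> pads_rows g' v' \<zeta> g) \<and> pads_steps g v g \<and> pads_steps g' v' g"

lemma link_closed:
  assumes t: "t \<in> term_ops F m" and e: "\<And>j. j < m \<Longrightarrow> link (g j) (v j) (g' j) (v' j)"
  shows "link (t (map g [0..<m])) (t (map v [0..<m])) (t (map g' [0..<m])) (t (map v' [0..<m]))"
proof -
  obtain \<zeta> where \<zeta>: "\<And>j. j < m \<Longrightarrow> \<zeta> j \<in> A \<and> pads_rows (g j) (v j) (\<zeta> j) (g j) \<and> pads_rows (g' j) (v' j) (\<zeta> j) (g j)"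
    using e unfolding link_def by metis
  show ?thesis unfolding link_def
    by (intro conjI bexI[of _ "t (map \<zeta> [0..<m])"] pads_rows_closed pads_steps_closed t
        closed_underD[OF closed_B t] closed_underD[OF closed_A t]) (use e \<zeta> in \<open>auto simp: link_def\<close>)
qed

text \<open>Of the last node only the second component \<open>x\<close> is kept; it becomes the
  value of the new hub.\<close>

primrec walk :: "nat \<Rightarrow> 'a \<Rightarrow> 'a \<Rightarrow> 'a \<Rightarrow> bool" where
  "walk 0 g v x \<longleftrightarrow> g \<in> B \<and> v \<in> A \<and> x = v"
| "walk (Suc j) g v x \<longleftrightarrow> (\<exists>g' v'. link g v g' v' \<and> walk j g' v' x)"

lemma walk_closed:
  assumes t: "t \<in> term_ops F m" and "\<And>i. i < m \<Longrightarrow> walk j (g i) (v i) (x i)"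
  shows "walk j (t (map g [0..<m])) (t (map v [0..<m])) (t (map x [0..<m]))"
  using assms(2)
proof (induction j arbitrary: g v)
  case 0
  have "t (map x [0..<m]) = t (map v [0..<m])" using 0 by (intro arg_cong[where f=t]) auto
  then show ?case using 0 closed_underD[OF closed_B t, of g] closed_underD[OF closed_A t, of v] by simp
next
  case (Suc j)
  then obtain g' v' where "\<And>i. i < m \<Longrightarrow> link (g i) (v i) (g' i) (v' i)" "\<And>i. i < m \<Longrightarrow> walk j (g' i) (v' i) (x i)"
    by (simp, metis)
  then show ?case using link_closed[OF t, of g v g' v'] Suc.IH[of g' v'] by auto
qed

lemma walk_in: "walk j g v x \<Longrightarrow> g \<in> B \<and> v \<in> A \<and> x \<in> A"
  by (induction j arbitrary: g v) (auto simp: link_def)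

text \<open>Dropping the last link shows that the first node of a critical link also starts a walk
  of the remaining length, and so receives a hub value.\<close>

lemma walk_pred: "walk (Suc j) g v x \<Longrightarrow> \<exists>x'. walk j g v x'"
proof (induction j arbitrary: g v)
  case 0
  then show ?case by (auto simp: link_def)
next
  case (Suc j)
  then obtain g' v' where e: "link g v g' v'" "walk (Suc j) g' v' x" by auto
  then obtain x' where "walk j g' v' x'" using Suc.IH by blast
  then show ?case using e(1) by auto
qed

text \<open>The nodes that extend to \<open>B\<close> over some hub tuple in \<open>B\<close>. The Jonsson terms yield a walk of links
  from an endable node into \<open>B \<times> B\<close>, which contains no endable node.\<close>

definition endable :: "'a \<Rightarrow> 'a \<Rightarrow> bool" where
  "endable g v \<longleftrightarrow> (\<exists>\<tau>\<in>P. (\<forall>c<h. \<tau> c \<in> B) \<and> (\<exists>q. \<forall>L. \<exists>z. (z, \<tau>) \<in> R \<and> z 0 = v \<and> (\<forall>l\<ge>1. z l \<in> B) \<and>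
     (\<forall>l. q < l \<and> l \<le> q + L \<longrightarrow> z l = g)))"

end

section \<open>Links produced by the Jonsson terms\<close>

locale jonsson_stage = stage +
  fixes d :: "nat \<Rightarrow> 'a list \<Rightarrow> 'a" and n :: nat
  assumes d_term: "k \<le> n \<Longrightarrow> d k \<in> term_ops F 3"
    and d_B: "k \<le> n \<Longrightarrow> x \<in> B \<Longrightarrow> z \<in> B \<Longrightarrow> a \<in> A \<Longrightarrow> d k [x, a, z] \<in> B"
    and d_step: "k < n \<Longrightarrow> x \<in> A \<Longrightarrow> z \<in> A \<Longrightarrow> d k [x, z, z] = d (Suc k) [x, x, z]"
    and d_first: "x \<in> A \<Longrightarrow> a \<in> A \<Longrightarrow> z \<in> A \<Longrightarrow> d 0 [x, a, z] = x"
    and d_last: "x \<in> A \<Longrightarrow> a \<in> A \<Longrightarrow> z \<in> A \<Longrightarrow> d n [x, a, z] = z"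
begin

text \<open>The nodes \<open>(cc k, ww k)\<close> lead from \<open>(\<beta>, \<beta>)\<close> at
  \<open>k = 0\<close> to \<open>(\<alpha>, \<xi>)\<close> at \<open>k = n\<close>.\<close>

definition "cc k = d k [\<beta>, \<beta>, \<alpha>]"
definition "ww k = d k [\<beta>, \<beta>, \<xi>]"

lemma d_A:
  assumes "k \<le> n" "x \<in> A" "a \<in> A" "z \<in> A"
  shows "d k [x, a, z] \<in> A"
proof -
  have "d k (map (\<lambda>j. [x, a, z] ! j) [0..<3]) \<in> A"
    by (rule closed_underD[OF closed_A d_term[OF assms(1)]])
       (use assms in \<open>auto simp: numeral_3_eq_3 less_Suc_eq\<close>)
  then show ?thesis by (simp add: numeral_3_eq_3)
qed

lemma d_idem:
  assumes "k \<le> n" "x \<in> A"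
  shows "d k [x, x, x] = x"
  using term_idem[OF d_term[OF assms(1)] assms(2)] by (simp add: numeral_3_eq_3)

lemma ccB: "k \<le> n \<Longrightarrow> cc k \<in> B"
  unfolding cc_def using \<alpha>B \<beta>B by (intro d_B) auto

lemma wwA: "k \<le> n \<Longrightarrow> ww k \<in> A"
  unfolding ww_def using \<xi>A by (intro d_A) auto

lemma cc_Suc: "k < n \<Longrightarrow> d k [\<beta>, \<alpha>, \<alpha>] = cc (Suc k)"
  unfolding cc_def by (intro d_step) auto

lemma ww_Suc: "k < n \<Longrightarrow> d k [\<beta>, \<xi>, \<xi>] = ww (Suc k)"
  unfolding ww_def using \<xi>A by (intro d_step) auto

lemma paddedI:
  assumes "(z, p) \<in> R" "z 0 = v" "\<And>l. 1 \<le> l \<Longrightarrow> l \<le> \<sigma> \<Longrightarrow> z l \<in> B"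
    "\<And>l. \<sigma> < l \<Longrightarrow> l \<le> \<sigma> + L \<Longrightarrow> z l = g"
    "\<And>l. \<sigma> + L < l \<Longrightarrow> l \<le> \<sigma> + L + \<rho> \<Longrightarrow> z l \<in> B"
    "\<And>l. z (l + (\<sigma> + L + \<rho> + 1)) = w l"
  shows "padded p v \<sigma> g L \<rho> w"
  using assms unfolding padded_def is_padded_def by blast

lemma eventually_padsI:
  assumes "\<And>\<sigma> L \<rho>. 1 \<le> \<sigma> \<Longrightarrow> 1 \<le> \<rho> \<Longrightarrow> Q \<sigma> L \<rho>"
  shows "eventually_pads Q"
  unfolding eventually_pads_def using assms
  by (auto simp: eventually_sequentially intro!: exI[of _ 1])

context
  fixes k assumes k: "k < n"
begin

lemma kn: "k \<le> n" using k by simp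

lemmas d_simps = cc_Suc[OF k] ww_Suc[OF k] d_idem[OF kn] cc_def[symmetric] ww_def[symmetric]

abbreviation "gk \<equiv> d k [\<xi>, \<alpha>, \<alpha>]"

text \<open>The first row has its \<open>\<xi>\<close> behind the prefix, the third at entry
  \<open>0\<close>. The position of \<open>\<xi>\<close> in the middle row selects the node; entry
  \<open>0\<close> gives the front value \<open>d k [\<beta>, \<xi>, \<xi>]\<close>.\<close>

lemma pads_rows_1: "pads_rows (cc (Suc k)) (ww (Suc k)) gk (cc (Suc k))"
  unfolding pads_rows_def
proof (rule eventually_padsI, intro ballI allI)
  fix \<sigma> L \<rho> i :: nat and p assume p: "p \<in> P"
  let ?z = "\<lambda>l. d k [row \<beta> \<xi> \<alpha> (i + (\<sigma> + L + \<rho> + 1)) l, row \<beta> \<xi> \<alpha> 0 l, row \<beta> \<xi> \<alpha> 0 l]"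
  show "padded p (ww (Suc k)) \<sigma> (cc (Suc k)) L \<rho> (row (cc (Suc k)) gk \<alpha> i)"
  proof (rule paddedI)
    show "(?z, p) \<in> R" by (intro closed3 d_term kn rows p)
    show "?z 0 = ww (Suc k)"  by (simp add: row_def d_simps)
    show "?z (l + (\<sigma> + L + \<rho> + 1)) = row (cc (Suc k)) gk \<alpha> i l" for l
       by (simp add: row_def d_simps)
    have z: "?z l = cc (Suc k)" if "1 \<le> l" "l \<le> \<sigma> + L + \<rho>" for l
      using that by (simp add: row_def d_simps)
    then show "?z l \<in> B" if "1 \<le> l" "l \<le> \<sigma>" for l using that k by (simp add: ccB)
    show "?z l = cc (Suc k)" if "\<sigma> < l" "l \<le> \<sigma> + L" for l using z that by simp
    show "?z l \<in> B" if "\<sigma> + L < l" "l \<le> \<sigma> + L + \<rho>" for l using z that k by (simp add: ccB)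
  qed
qed

text \<open>With the middle \<open>\<xi>\<close> at entry \<open>1\<close> the front value becomes
  \<open>ww k\<close>, and the spare entry \<open>1\<close> takes
  \<open>d k [\<beta>, \<xi>, \<alpha>]\<close>, which lies in \<open>B\<close>.\<close>

lemma pads_rows_2: "pads_rows (cc (Suc k)) (ww k) gk (cc (Suc k))"
  unfolding pads_rows_def
proof (rule eventually_padsI, intro ballI allI)
  fix \<sigma> L \<rho> i :: nat and p assume p: "p \<in> P" and \<sigma>: "1 \<le> \<sigma>"
  let ?z = "\<lambda>l. d k [row \<beta> \<xi> \<alpha> (i + (\<sigma> + L + \<rho> + 1)) l, row \<beta> \<xi> \<alpha> 1 l, row \<beta> \<xi> \<alpha> 0 l]"
  show "padded p (ww k) \<sigma> (cc (Suc k)) L \<rho> (row (cc (Suc k)) gk \<alpha> i)"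
  proof (rule paddedI)
    show "(?z, p) \<in> R" by (intro closed3 d_term kn rows p)
    show "?z 0 = ww k"  by (simp add: row_def d_simps)
    show "?z (l + (\<sigma> + L + \<rho> + 1)) = row (cc (Suc k)) gk \<alpha> i l" for l
      using \<sigma> by (simp add: row_def d_simps)
    have z: "?z l = cc (Suc k)" if "1 < l" "l \<le> \<sigma> + L + \<rho>" for l
      using that by (simp add: row_def d_simps)
    have "?z 1 \<in> B" using \<sigma> d_B[OF kn \<beta>B \<alpha>B \<xi>A] by (simp add: row_def)
    then show "?z l \<in> B" if "1 \<le> l" "l \<le> \<sigma>" for l
      using that k z by (cases "l = 1") (simp_all add: ccB)
    show "?z l = cc (Suc k)" if "\<sigma> < l" "l \<le> \<sigma> + L" for l using z that \<sigma> by simp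
    show "?z l \<in> B" if "\<sigma> + L < l" "l \<le> \<sigma> + L + \<rho>" for l using z that k \<sigma> by (simp add: ccB)
  qed
qed

text \<open>With the middle \<open>\<xi>\<close> just behind the block, the block consists of
  \<open>d k [\<beta>, \<beta>, \<alpha>]\<close>, that is, of \<open>cc k\<close>.\<close>

lemma pads_rows_3: "pads_rows (cc k) (ww k) gk (cc (Suc k))"
  unfolding pads_rows_def
proof (rule eventually_padsI, intro ballI allI)
  fix \<sigma> L \<rho> i :: nat and p assume p: "p \<in> P" and \<rho>: "1 \<le> \<rho>"
  let ?z = "\<lambda>l. d k [row \<beta> \<xi> \<alpha> (i + (\<sigma> + L + \<rho> + 1)) l, row \<beta> \<xi> \<alpha> (\<sigma> + L + 1) l, row \<beta> \<xi> \<alpha> 0 l]"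
  show "padded p (ww k) \<sigma> (cc k) L \<rho> (row (cc (Suc k)) gk \<alpha> i)"
  proof (rule paddedI)
    show "(?z, p) \<in> R" by (intro closed3 d_term kn rows p)
    show "?z 0 = ww k"  by (simp add: row_def d_simps)
    show "?z (l + (\<sigma> + L + \<rho> + 1)) = row (cc (Suc k)) gk \<alpha> i l" for l
      using \<rho> by (simp add: row_def d_simps)
    have z: "?z l = cc k" if "1 \<le> l" "l \<le> \<sigma> + L" for l
      using that by (simp add: row_def d_simps)
    have z': "?z l = cc (Suc k)" if "\<sigma> + L + 1 < l" "l \<le> \<sigma> + L + \<rho>" for l
      using that by (simp add: row_def d_simps)
    have z'': "?z (\<sigma> + L + 1) \<in> B" using d_B[OF kn \<beta>B \<alpha>B \<xi>A] \<rho> by (simp add: row_def)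
    show "?z l \<in> B" if "1 \<le> l" "l \<le> \<sigma>" for l using that z ccB[OF kn] by simp
    show "?z l = cc k" if "\<sigma> < l" "l \<le> \<sigma> + L" for l using z that by simp
    show "?z l \<in> B" if "\<sigma> + L < l" "l \<le> \<sigma> + L + \<rho>" for l
    proof (cases "l = \<sigma> + L + 1")
      case True
      then show ?thesis using z'' by simp
    next
      case False
      then show ?thesis using z'[of l] that k ccB[of "Suc k"] by simp
    qed
  qed
qed

lemma step_ex:
  assumes "p \<in> PX"
  shows "\<exists>z. (z, p) \<in> R \<and> (\<forall>l. z l \<in> B) \<and> (\<forall>l<M. z l = \<beta>)"
  using assms steps by auto

lemma step_ev_ex:
  assumes "p \<in> PX"
  shows "\<exists>z N. (z, p) \<in> R \<and> (\<forall>l. z l \<in> B) \<and> (\<forall>l<M. z l = \<beta>) \<and> (\<forall>l\<ge>N. z l = \<alpha>)"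
  using step_ex[OF assms, of M] R_ev by metis

lemma row0: "row \<beta> \<xi> \<alpha> 0 l = (if l = 0 then \<xi> else \<alpha>)"
  by (simp add: row_def)

lemma B_in_A: "x \<in> B \<Longrightarrow> x \<in> A"
  using BA by auto

text \<open>The first argument is now a sequence over \<open>B\<close> from \<open>steps\<close>.
  From entry \<open>1\<close> on the third argument is \<open>\<alpha>\<close>, so the values stay
  in \<open>B\<close> whatever the middle argument is.\<close>

lemma pads_steps_1: "pads_steps (cc (Suc k)) (ww (Suc k)) (cc (Suc k))"
  unfolding pads_steps_def
proof (rule eventually_padsI, intro ballI allI)
  fix \<sigma> L \<rho> K :: nat and p assume p: "p \<in> PX"
  obtain z1 where z1: "(z1, p) \<in> R" "\<And>l. z1 l \<in> B" "\<And>l. l < \<sigma> + L + \<rho> + 1 + K \<Longrightarrow> z1 l = \<beta>"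
    using step_ex[OF p, of "\<sigma> + L + \<rho> + 1 + K"] by blast
  let ?z = "\<lambda>l. d k [z1 l, row \<beta> \<xi> \<alpha> 0 l, row \<beta> \<xi> \<alpha> 0 l]"
  let ?w = "\<lambda>l. ?z (l + (\<sigma> + L + \<rho> + 1))"
  have zR: "(?z, p) \<in> R" using p z1 by (intro closed3 d_term kn rows) auto
  have zB: "?z l \<in> B" if "1 \<le> l" for l
    using that z1(2) \<alpha>B by (auto simp: row0 intro!: d_B kn)
  have "padded p (ww (Suc k)) \<sigma> (cc (Suc k)) L \<rho> ?w"
  proof (rule paddedI[OF zR])
    show "?z 0 = ww (Suc k)" using z1(3)[of 0] by (simp add: row0 d_simps)
    show "?z l = cc (Suc k)" if "\<sigma> < l" "l \<le> \<sigma> + L" for l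
      using that z1(3)[of l] by (simp add: row0 d_simps)
    show "?z l \<in> B" if "1 \<le> l" for l using zB[OF that] .
    show "?z l \<in> B" if "\<sigma> + L < l" for l using zB[of l] that by simp
  qed simp
  moreover have "?w l \<in> B" for l by (rule zB) simp
  moreover have "?w l = cc (Suc k)" if "l < K" for l
    using that z1(3)[of "l + (\<sigma> + L + \<rho> + 1)"] by (simp add: row0 d_simps)
  ultimately show "\<exists>w. padded p (ww (Suc k)) \<sigma> (cc (Suc k)) L \<rho> w \<and> (\<forall>l. w l \<in> B) \<and> (\<forall>l<K. w l = cc (Suc k))"
    by blast
qed

text \<open>The middle argument also comes from \<open>steps\<close>. It changes from
  \<open>\<beta>\<close> to \<open>\<alpha>\<close> within the first spare entries once
  \<open>\<sigma>\<close> reaches \<open>N\<close>.\<close>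

lemma pads_steps_2: "pads_steps (cc (Suc k)) (ww k) (cc (Suc k))"
proof -
  have "eventually_pads (\<lambda>\<sigma> L \<rho>. \<forall>K. \<exists>w. padded p (ww k) \<sigma> (cc (Suc k)) L \<rho> w \<and> (\<forall>l. w l \<in> B) \<and> (\<forall>l<K. w l = cc (Suc k)))"
    if p: "p \<in> PX" for p
  proof -
    obtain z2 N where z2: "(z2, p) \<in> R" "\<And>l. z2 l \<in> B" "\<And>l. l < 1 \<Longrightarrow> z2 l = \<beta>"
      "\<And>l. l \<ge> N \<Longrightarrow> z2 l = \<alpha>"
      using step_ev_ex[OF p, of 1] by blast
    have "\<exists>w. padded p (ww k) \<sigma> (cc (Suc k)) L \<rho> w \<and> (\<forall>l. w l \<in> B) \<and> (\<forall>l<K. w l = cc (Suc k))"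
      if \<sigma>: "\<sigma> \<ge> N" for \<sigma> L \<rho> K
    proof -
      obtain z1 where z1: "(z1, p) \<in> R" "\<And>l. z1 l \<in> B" "\<And>l. l < \<sigma> + L + \<rho> + 1 + K \<Longrightarrow> z1 l = \<beta>"
        using step_ex[OF p, of "\<sigma> + L + \<rho> + 1 + K"] by blast
      let ?z = "\<lambda>l. d k [z1 l, z2 l, row \<beta> \<xi> \<alpha> 0 l]"
      let ?w = "\<lambda>l. ?z (l + (\<sigma> + L + \<rho> + 1))"
      have zR: "(?z, p) \<in> R" using p z1 z2 by (intro closed3 d_term kn rows) auto
      have zB: "?z l \<in> B" if "1 \<le> l" for l
        using that z1(2) z2(2) \<alpha>B B_in_A by (auto simp: row0 intro!: d_B kn)
      have "padded p (ww k) \<sigma> (cc (Suc k)) L \<rho> ?w"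
      proof (rule paddedI[OF zR])
        show "?z 0 = ww k" using z1(3)[of 0] z2(3)[of 0] by (simp add: row0 d_simps)
        show "?z l = cc (Suc k)" if "\<sigma> < l" "l \<le> \<sigma> + L" for l
          using that z1(3)[of l] z2(4)[of l] \<sigma> by (simp add: row0 d_simps)
        show "?z l \<in> B" if "1 \<le> l" for l using zB[OF that] .
        show "?z l \<in> B" if "\<sigma> + L < l" for l using zB[of l] that by simp
      qed simp
      moreover have "?w l \<in> B" for l by (rule zB) simp
      moreover have "?w l = cc (Suc k)" if "l < K" for l
        using that z1(3)[of "l + (\<sigma> + L + \<rho> + 1)"] z2(4)[of "l + (\<sigma> + L + \<rho> + 1)"] \<sigma>
        by (simp add: row0 d_simps)
      ultimately show ?thesis by blast
    qed
    then show ?thesis unfolding eventually_pads_def by (auto simp: eventually_sequentially intro!: exI[of _ N])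
  qed
  then show ?thesis unfolding pads_steps_def using finite_box by (intro eventually_pads_ball) auto
qed

text \<open>The middle argument has to remain \<open>\<beta>\<close> through the block, so the start
  \<open>N\<close> of its tail depends on \<open>\<sigma>\<close> and \<open>L\<close>, and
  \<open>\<rho>\<close> is chosen last.\<close>

lemma pads_steps_3: "pads_steps (cc k) (ww k) (cc (Suc k))"
proof -
  have "eventually_pads (\<lambda>\<sigma> L \<rho>. \<forall>K. \<exists>w. padded p (ww k) \<sigma> (cc k) L \<rho> w \<and> (\<forall>l. w l \<in> B) \<and> (\<forall>l<K. w l = cc (Suc k)))"
    if p: "p \<in> PX" for p
    unfolding eventually_pads_def
  proof (rule always_eventually, intro allI)
    fix \<sigma> L :: nat
    obtain z2 N where z2: "(z2, p) \<in> R" "\<And>l. z2 l \<in> B" "\<And>l. l < \<sigma> + L + 1 \<Longrightarrow> z2 l = \<beta>"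
      "\<And>l. l \<ge> N \<Longrightarrow> z2 l = \<alpha>"
      using step_ev_ex[OF p, of "\<sigma> + L + 1"] by blast
    have "\<exists>w. padded p (ww k) \<sigma> (cc k) L \<rho> w \<and> (\<forall>l. w l \<in> B) \<and> (\<forall>l<K. w l = cc (Suc k))"
      if \<rho>: "\<rho> \<ge> N" for \<rho> K
    proof -
      obtain z1 where z1: "(z1, p) \<in> R" "\<And>l. z1 l \<in> B" "\<And>l. l < \<sigma> + L + \<rho> + 1 + K \<Longrightarrow> z1 l = \<beta>"
        using step_ex[OF p, of "\<sigma> + L + \<rho> + 1 + K"] by blast
      let ?z = "\<lambda>l. d k [z1 l, z2 l, row \<beta> \<xi> \<alpha> 0 l]"
      let ?w = "\<lambda>l. ?z (l + (\<sigma> + L + \<rho> + 1))"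
      have zR: "(?z, p) \<in> R" using p z1 z2 by (intro closed3 d_term kn rows) auto
      have zB: "?z l \<in> B" if "1 \<le> l" for l
        using that z1(2) z2(2) \<alpha>B B_in_A by (auto simp: row0 intro!: d_B kn)
      have "padded p (ww k) \<sigma> (cc k) L \<rho> ?w"
      proof (rule paddedI[OF zR])
        show "?z 0 = ww k" using z1(3)[of 0] z2(3)[of 0] by (simp add: row0 d_simps)
        show "?z l = cc k" if "\<sigma> < l" "l \<le> \<sigma> + L" for l
          using that z1(3)[of l] z2(3)[of l] by (simp add: row0 d_simps)
        show "?z l \<in> B" if "1 \<le> l" for l using zB[OF that] .
        show "?z l \<in> B" if "\<sigma> + L < l" for l using zB[of l] that by simp
      qed simp
      moreover have "?w l \<in> B" for l by (rule zB) simp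
      moreover have "?w l = cc (Suc k)" if "l < K" for l
        using that z1(3)[of "l + (\<sigma> + L + \<rho> + 1)"] z2(4)[of "l + (\<sigma> + L + \<rho> + 1)"] \<rho>
        by (simp add: row0 d_simps)
      ultimately show ?thesis by blast
    qed
    then show "\<forall>\<^sub>F \<rho> in sequentially. \<forall>K. \<exists>w. padded p (ww k) \<sigma> (cc k) L \<rho> w \<and> (\<forall>l. w l \<in> B) \<and> (\<forall>l<K. w l = cc (Suc k))"
      by (auto simp: eventually_sequentially intro!: exI[of _ N])
  qed
  then show ?thesis unfolding pads_steps_def using finite_box by (intro eventually_pads_ball) auto
qed

lemma gk_A: "gk \<in> A"
  using \<xi>A by (intro d_A kn) auto

text \<open>This link changes the front value and keeps the block value; \<open>link_base\<close>
  does the opposite. Hence \<open>walk_path\<close> has two links per Jonsson term.\<close>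

lemma link_hub: "link (cc (Suc k)) (ww (Suc k)) (cc (Suc k)) (ww k)"
  unfolding link_def using k ccB wwA pads_rows_1 pads_rows_2 pads_steps_1 pads_steps_2 gk_A by auto

lemma link_base: "link (cc (Suc k)) (ww k) (cc k) (ww k)"
  unfolding link_def using k ccB wwA pads_rows_3 pads_rows_2 pads_steps_3 pads_steps_2 gk_A by auto

end

lemma walk_path: "k \<le> n \<Longrightarrow> walk (2 * k) (cc k) (ww k) \<beta>"
proof (induction k)
  case 0
  then show ?case using d_first \<beta>B \<xi>A ccB[of 0] by (auto simp: cc_def ww_def)
next
  case (Suc k)
  then show ?case using link_hub[of k] link_base[of k] by auto
qed

lemma endable_end: "endable (cc n) (ww n)"
proof -
  have "cc n = \<alpha>" "ww n = \<xi>" using d_last \<xi>A by (auto simp: cc_def ww_def)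
  moreover obtain \<tau> where \<tau>: "\<tau> \<in> P" "\<forall>c<h. \<tau> c \<in> B" using box_B_ex by blast
  ultimately show ?thesis unfolding endable_def using rows[OF \<tau>(1), of 0] \<alpha>B
    by (intro bexI[OF _ \<tau>(1)] conjI exI[of _ 0] allI exI[of _ "row \<beta> \<xi> \<alpha> 0"]) (auto simp: row_def)
qed

lemma not_endable_0: "x \<in> B \<Longrightarrow> walk 0 g v x \<Longrightarrow> \<not> endable g v"
proof
  assume x: "x \<in> B" "walk 0 g v x" and "endable g v"
  then obtain \<tau> z where \<tau>: "\<tau> \<in> P" "\<forall>c<h. \<tau> c \<in> B" and z: "(z, \<tau>) \<in> R" "z 0 = v" "\<forall>l\<ge>1. z l \<in> B"
    unfolding endable_def by blast
  have "z l \<in> B" for l using z x by (cases l) auto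
  then show False using bad[OF z(1) \<tau>(1)] \<tau>(2) by blast
qed

lemma critical_edge:
  obtains j g v g' v' u where "link g v g' v'" "walk j g' v' u" "u \<in> B" "endable g v"
    "\<And>g v x. walk j g v x \<Longrightarrow> x \<in> B \<Longrightarrow> \<not> endable g v"
proof -
  define W where "W m \<longleftrightarrow> (\<exists>g v. \<exists>x\<in>B. walk m g v x \<and> endable g v)" for m
  have "W (2 * n)" unfolding W_def using walk_path[of n] endable_end \<beta>B by blast
  \<comment> \<open>A shortest walk from an endable node into \<open>B\<close> has positive length.
    Its first link is the critical one, and minimality gives the last clause.\<close>
  then obtain m where m: "W m" "\<And>m'. m' < m \<Longrightarrow> \<not> W m'" using exists_least_iff[of W] by blast
  then obtain j where j: "m = Suc j" using not_endable_0 unfolding W_def by (cases m) blast+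
  then have "\<not> W j" using m by simp
  moreover obtain g v x where "x \<in> B" "walk (Suc j) g v x" "endable g v" using m(1) j unfolding W_def by blast
  ultimately show thesis using that unfolding W_def by (metis walk.simps(2))
qed

end

section \<open>Splitting off one more hub\<close>

context jonsson_stage
begin

text \<open>A node that is not endable fails for \<open>q = \<sigma>\<close> at some
  \<open>L\<close>. A larger \<open>L\<close> only strengthens the excluded condition, so the
  maximum over the finitely many nodes and box elements works for all.\<close>

lemma not_endable_bound:
  assumes W: "\<And>g v x. walk j g v x \<Longrightarrow> x \<in> B \<Longrightarrow> \<not> endable g v"
  shows "\<exists>L. \<forall>g v x \<tau> z. walk j g v x \<longrightarrow> x \<in> B \<longrightarrow> \<tau> \<in> P \<longrightarrow> (\<forall>c<h. \<tau> c \<in> B) \<longrightarrow> (z, \<tau>) \<in> R \<longrightarrow>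
    z 0 = v \<longrightarrow> (\<forall>l\<ge>1. z l \<in> B) \<longrightarrow> \<not> (\<forall>l. \<sigma> < l \<and> l \<le> \<sigma> + L \<longrightarrow> z l = g)"
proof -
  let ?S = "B \<times> A \<times> P"
  define Z where "Z g v \<tau> L z \<longleftrightarrow> (\<forall>c<h. \<tau> c \<in> B) \<and> (z, \<tau>) \<in> R \<and> z 0 = v \<and> (\<forall>l\<ge>1. z l \<in> B) \<and>
     (\<forall>l. \<sigma> < l \<and> l \<le> \<sigma> + L \<longrightarrow> z l = g)" for g v \<tau> L z
  have "\<exists>L. \<forall>z. \<tau> \<in> P \<longrightarrow> (\<exists>x\<in>B. walk j g v x) \<longrightarrow> \<not> Z g v \<tau> L z" for g v \<tau>
  proof (rule ccontr)
    assume "\<not> ?thesis"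
    then have *: "\<tau> \<in> P" "\<exists>x\<in>B. walk j g v x" "\<And>L. \<exists>z. Z g v \<tau> L z" by blast+
    from *(3)[of 0] have "\<forall>c<h. \<tau> c \<in> B" by (auto simp: Z_def)
    then have "endable g v" unfolding endable_def using *(1,3) unfolding Z_def by blast
    then show False using *(2) W by blast
  qed
  then have "\<forall>g v \<tau>. \<exists>L. \<forall>z. \<tau> \<in> P \<longrightarrow> (\<exists>x\<in>B. walk j g v x) \<longrightarrow> \<not> Z g v \<tau> L z" by blast
  then obtain b where "\<forall>g v \<tau> z. \<tau> \<in> P \<longrightarrow> (\<exists>x\<in>B. walk j g v x) \<longrightarrow> \<not> Z g v \<tau> (b g v \<tau>) z"
    unfolding choice_iff by blast
  then have b: "\<And>g v \<tau> z x. \<tau> \<in> P \<Longrightarrow> x \<in> B \<Longrightarrow> walk j g v x \<Longrightarrow> \<not> Z g v \<tau> (b g v \<tau>) z"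
    by blast
  have fin_S: "finite ?S" using finite_subset[OF BA fin] fin finite_box by simp
  define L where "L = Max ((\<lambda>(g, v, \<tau>). b g v \<tau>) ` ?S)"
  have L: "b g v \<tau> \<le> L" if "g \<in> B" "v \<in> A" "\<tau> \<in> P" for g v \<tau>
    unfolding L_def using that fin_S by (intro Max_ge) force+
  show ?thesis
  proof (intro exI[of _ L] allI impI notI)
    fix g v x \<tau> z
    assume a: "walk j g v x" "x \<in> B" "\<tau> \<in> P" "\<forall>c<h. \<tau> c \<in> B"
      "(z, \<tau>) \<in> R" "z 0 = v" "\<forall>l\<ge>1. z l \<in> B" "\<forall>l. \<sigma> < l \<and> l \<le> \<sigma> + L \<longrightarrow> z l = g"
    have "b g v \<tau> \<le> L" using walk_in[OF a(1)] a(3) by (intro L) auto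
    then have "Z g v \<tau> (b g v \<tau>) z" unfolding Z_def using a by auto
    then show False using b[OF a(3,2,1)] by blast
  qed
qed

text \<open>Along a walk from an endable node into \<open>B \<times> B\<close> there is a last link \<open>(g, v)\<close>, \<open>(g', v')\<close> at which
  endability is lost. The value of the new hub is the end point of a walk of the remaining length
  \<open>j\<close>, so that values in \<open>B\<close> only come from nodes that are not endable. Shrinking \<open>D c\<close> to the
  subuniverse generated by \<open>y c\<close> and \<open>\<tau> c\<close> turns the single tuple \<open>\<tau>\<close> witnessing endability into a
  whole box.\<close>

lemma next_stage: "\<exists>R' D' y' \<beta>' \<xi>'. stage A F B R' D' y' \<alpha> \<beta>' \<xi>' (Suc h)"
proof -
  obtain j g v g' v' u where edge: "link g v g' v'" and Gu: "walk j g' v' u" and u: "u \<in> B" and Vgv: "endable g v"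
    and W: "\<And>g v x. walk j g v x \<Longrightarrow> x \<in> B \<Longrightarrow> \<not> endable g v"
    by (rule critical_edge) blast
  have "walk (Suc j) g v u" using edge Gu by auto
  \<comment> \<open>Since \<open>(g, v)\<close> is endable, \<open>W\<close> keeps \<open>yn\<close>
    outside \<open>B\<close>, whereas the value \<open>u\<close> at \<open>(g', v')\<close> lies in
    \<open>B\<close>.\<close>
  then obtain yn where Gy: "walk j g v yn" using walk_pred by blast
  have gB: "g \<in> B" and uA: "u \<in> A" and yA: "yn \<in> A" using walk_in[OF Gy] walk_in[OF Gu] by auto
  have gA: "g \<in> A" using gB BA by auto
  obtain \<zeta> where \<zeta>: "\<zeta> \<in> A" "pads_rows g v \<zeta> g" "pads_rows g' v' \<zeta> g" "pads_steps g v g" "pads_steps g' v' g"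
    using edge by (auto simp: link_def)
  obtain \<tau> q where \<tau>: "\<tau> \<in> P" "\<And>c. c < h \<Longrightarrow> \<tau> c \<in> B"
    and q: "\<And>L. \<exists>z. (z, \<tau>) \<in> R \<and> z 0 = v \<and> (\<forall>l\<ge>1. z l \<in> B) \<and> (\<forall>l. q < l \<and> l \<le> q + L \<longrightarrow> z l = g)"
    using Vgv unfolding endable_def by blast
  define \<Phi> where "\<Phi> \<sigma> L \<rho> \<longleftrightarrow>
     (\<forall>p\<in>P. \<forall>i. padded p v \<sigma> g L \<rho> (row g \<zeta> \<alpha> i)) \<and> (\<forall>p\<in>P. \<forall>i. padded p v' \<sigma> g' L \<rho> (row g \<zeta> \<alpha> i)) \<and>
     (\<forall>p\<in>PX. \<forall>K. \<exists>w. padded p v \<sigma> g L \<rho> w \<and> (\<forall>l. w l \<in> B) \<and> (\<forall>l<K. w l = g)) \<and>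
     (\<forall>p\<in>PX. \<forall>K. \<exists>w. padded p v' \<sigma> g' L \<rho> w \<and> (\<forall>l. w l \<in> B) \<and> (\<forall>l<K. w l = g))" for \<sigma> L \<rho>
  have "eventually_pads \<Phi>"
    unfolding \<Phi>_def using \<zeta>(2-) unfolding pads_rows_def pads_steps_def by (intro eventually_pads_conj)
  \<comment> \<open>With \<open>q \<le> \<sigma>\<close> the block lies inside the run of
    \<open>g\<close> of any sufficiently long witness of endability.\<close>
  then obtain \<sigma> where \<sigma>: "q \<le> \<sigma>" "\<And>L. \<forall>\<^sub>F \<rho> in sequentially. \<Phi> \<sigma> L \<rho>"
    unfolding eventually_pads_def eventually_sequentially by (metis linear)
  obtain L where L: "\<And>g v x \<tau> z. walk j g v x \<Longrightarrow> x \<in> B \<Longrightarrow> \<tau> \<in> P \<Longrightarrow> \<forall>c<h. \<tau> c \<in> B \<Longrightarrow> (z, \<tau>) \<in> R \<Longrightarrow>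
    z 0 = v \<Longrightarrow> \<forall>l\<ge>1. z l \<in> B \<Longrightarrow> \<not> (\<forall>l. \<sigma> < l \<and> l \<le> \<sigma> + L \<longrightarrow> z l = g)"
    using not_endable_bound[of j \<sigma>] W by blast
  obtain \<rho> where \<rho>: "\<Phi> \<sigma> L \<rho>" using \<sigma>(2)[of L] by (auto simp: eventually_sequentially)
  define R' where "R' = {(z, p(h := x)) | z p x. \<exists>g v. walk j g v x \<and> padded p v \<sigma> g L \<rho> z}"
  define D' where "D' c = (if c < h then sg {y c, \<tau> c} else sg {yn, u})" for c
  define y' where "y' = y(h := yn)"
  have R'I: "(z, p(h := x)) \<in> R'" if "walk j g v x" "padded p v \<sigma> g L \<rho> z" for z p x g v
    using that unfolding R'_def by blast
  have R'link: "\<exists>p g v x. p' = p(h := x) \<and> walk j g v x \<and> padded p v \<sigma> g L \<rho> z" if "(z, p') \<in> R'" for z p'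
    using that unfolding R'_def by blast
  have clR': "closed_rel R'"
    unfolding closed_rel_def
  proof (intro allI ballI impI)
    fix m t and z p' :: "nat \<Rightarrow> nat \<Rightarrow> 'a" assume t: "t \<in> term_ops F m" and zp: "\<forall>i<m. (z i, p' i) \<in> R'"
    have "\<forall>i. \<exists>p g v x. i < m \<longrightarrow> p' i = p(h := x) \<and> walk j g v x \<and> padded p v \<sigma> g L \<rho> (z i)"
      using zp R'link by blast
    then obtain p gg vv x where *: "\<And>i. i < m \<Longrightarrow> p' i = (p i)(h := x i)"
      "\<And>i. i < m \<Longrightarrow> walk j (gg i) (vv i) (x i)" "\<And>i. i < m \<Longrightarrow> padded (p i) (vv i) \<sigma> (gg i) L \<rho> (z i)"
      by metis
    have "(\<lambda>c. t (map (\<lambda>i. p' i c) [0..<m])) = (\<lambda>c. t (map (\<lambda>i. p i c) [0..<m]))(h := t (map x [0..<m]))"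
    proof
      fix c
      show "t (map (\<lambda>i. p' i c) [0..<m]) = ((\<lambda>c. t (map (\<lambda>i. p i c) [0..<m]))(h := t (map x [0..<m]))) c"
        by (cases "c = h") (use *(1) in \<open>auto intro!: arg_cong[where f=t]\<close>)
    qed
    then show "(\<lambda>l. t (map (\<lambda>i. z i l) [0..<m]), \<lambda>c. t (map (\<lambda>i. p' i c) [0..<m])) \<in> R'"
      using R'I[OF walk_closed[OF t *(2)] padded_closed[OF t *(3)]] by simp
  qed
  have D'_D: "D' c \<subseteq> D c" if c: "c < h" for c
  proof -
    have "sg {y c, \<tau> c} \<subseteq> D c"
      using y_D[OF c] \<tau>(1) c by (intro sg_least D_closed D_A) (auto simp: box_def)
    then show ?thesis using c by (simp add: D'_def)
  qed
  have D'_A: "D' c \<subseteq> A" if "c < Suc h" for c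
  proof (cases "c < h")
    case True
    then show ?thesis using D'_D D_A by blast
  next
    case False
    then show ?thesis using sg_least[OF closed_A, of "{yn, u}"] uA yA by (simp add: D'_def)
  qed
  have D'h: "D' h = sg {yn, u}" by (simp add: D'_def)
  have restrict: "p(h := \<alpha>) \<in> box D' h \<alpha>" "p = (p(h := \<alpha>))(h := p h)" "p h \<in> sg {yn, u}"
    if "p \<in> box D' (Suc h) \<alpha>" for p
    using that D'h by (auto simp: box_def)
  have sub: "box D' h \<alpha> \<subseteq> P" using D'_D by (auto simp: box_def)
  have new_rows: "(row g \<zeta> \<alpha> i, p') \<in> R'" if p': "p' \<in> box D' (Suc h) \<alpha>" for p' i
  proof -
    let ?p = "p'(h := \<alpha>)"
    have p: "?p \<in> P" using restrict(1)[OF p'] sub by blast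
    \<comment> \<open>The hub values compatible with a fixed row form a subuniverse; the two nodes
      of the link put \<open>yn\<close> and \<open>u\<close> into it.\<close>
    let ?S = "{x \<in> A. (row g \<zeta> \<alpha> i, ?p(h := x)) \<in> R'}"
    have "sg {yn, u} \<subseteq> ?S"
    proof (rule sg_least)
      have "(row g \<zeta> \<alpha> i, ?p(h := yn)) \<in> R'" using \<rho> p Gy unfolding \<Phi>_def by (intro R'I) auto
      moreover have "(row g \<zeta> \<alpha> i, ?p(h := u)) \<in> R'" using \<rho> p Gu unfolding \<Phi>_def by (intro R'I) auto
      ultimately show "{yn, u} \<subseteq> ?S" using yA uA by simp
      show "closed_under F ?S" unfolding closed_under_def
      proof (intro allI ballI impI)
        fix m t and e :: "nat \<Rightarrow> 'a" assume t: "t \<in> term_ops F m" and e: "\<forall>i<m. e i \<in> ?S"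
        have r1: "(\<lambda>l. t (map (\<lambda>_. row g \<zeta> \<alpha> i l) [0..<m]), \<lambda>c. t (map (\<lambda>k. (?p(h := e k)) c) [0..<m])) \<in> R'"
          using closed_relD[OF clR' t, of "\<lambda>_. row g \<zeta> \<alpha> i" "\<lambda>k. ?p(h := e k)"] e by blast
        have r2: "(\<lambda>l. t (map (\<lambda>_. row g \<zeta> \<alpha> i l) [0..<m])) = row g \<zeta> \<alpha> i"
          using term_idem[OF t] gA \<zeta>(1) by (auto simp: row_def)
        have "(row g \<zeta> \<alpha> i, ?p(h := t (map e [0..<m]))) \<in> R'"
          using r1 unfolding r2 term_upd[OF t box_A[OF p]] .
        then show "t (map e [0..<m]) \<in> ?S" using closed_underD[OF closed_A t, of e] e by blast
      qed
    qed auto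
    then show ?thesis using restrict(2,3)[OF p'] by (metis (no_types, lifting) mem_Collect_eq subsetD)
  qed
  \<comment> \<open>This is the conclusion of \<open>steps\<close> for one hub tuple. It is
    inherited through terms, so along one coordinate it spreads from two values to the subuniverse
    they generate.\<close>
  define steppy where "steppy p \<longleftrightarrow> (\<forall>K. \<exists>z. (z, p) \<in> R' \<and> (\<forall>l. z l \<in> B) \<and> (\<forall>l<K. z l = g))" for p
  have steppy_closed: "steppy (\<lambda>c. t (map (\<lambda>i. p i c) [0..<m]))"
    if t: "t \<in> term_ops F m" and p: "\<And>i. i < m \<Longrightarrow> steppy (p i)" for t m p
    unfolding steppy_def
  proof
    fix K
    have "\<forall>i. \<exists>z. i < m \<longrightarrow> (z, p i) \<in> R' \<and> (\<forall>l. z l \<in> B) \<and> (\<forall>l<K. z l = g)"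
      using p unfolding steppy_def by blast
    then obtain z where z: "\<And>i. i < m \<Longrightarrow> (z i, p i) \<in> R' \<and> (\<forall>l. z i l \<in> B) \<and> (\<forall>l<K. z i l = g)"
      by metis
    show "\<exists>z. (z, \<lambda>c. t (map (\<lambda>i. p i c) [0..<m])) \<in> R' \<and> (\<forall>l. z l \<in> B) \<and> (\<forall>l<K. z l = g)"
      by (rule exI[of _ "\<lambda>l. t (map (\<lambda>i. z i l) [0..<m])"], intro conjI allI impI
          closed_relD[OF clR' t] closed_underD[OF closed_B t] term_const[OF t gA]) (use z in auto)
  qed
  have steppy_line: "steppy (p(c := x))"
    if p: "\<And>c. p c \<in> A" and ab: "steppy (p(c := a))" "steppy (p(c := b))" "a \<in> A" "b \<in> A" and x: "x \<in> sg {a, b}"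
    for p c a b x
  proof -
    have "sg {a, b} \<subseteq> {x \<in> A. steppy (p(c := x))}"
    proof (rule sg_least)
      show "closed_under F {x \<in> A. steppy (p(c := x))}" unfolding closed_under_def
      proof (intro allI ballI impI)
        fix m t and e :: "nat \<Rightarrow> 'a" assume t: "t \<in> term_ops F m" and e: "\<forall>i<m. e i \<in> {x \<in> A. steppy (p(c := x))}"
        then have "steppy (\<lambda>k. t (map (\<lambda>i. (p(c := e i)) k) [0..<m]))"
          using steppy_closed[OF t, of "\<lambda>i. p(c := e i)"] by blast
        then have "steppy (p(c := t (map e [0..<m])))" unfolding term_upd[OF t p] .
        then show "t (map e [0..<m]) \<in> {x \<in> A. steppy (p(c := x))}"
          using closed_underD[OF closed_A t, of e] e by auto
      qed
    qed (use ab in auto)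
    then show ?thesis using x by auto
  qed
  have \<rho>X: "\<exists>w. padded p v \<sigma> g L \<rho> w \<and> (\<forall>l. w l \<in> B) \<and> (\<forall>l<K. w l = g)"
    "\<exists>w. padded p v' \<sigma> g' L \<rho> w \<and> (\<forall>l. w l \<in> B) \<and> (\<forall>l<K. w l = g)" if "p \<in> PX" for p K
    using \<rho> that unfolding \<Phi>_def by simp_all
  have steppy_y: "steppy (p(h := yn))" if "p \<in> PX" for p
    unfolding steppy_def using \<rho>X(1)[OF that] R'I[OF Gy] by meson
  have steppy_u: "steppy (p(h := u))" if "p \<in> PX" for p
    unfolding steppy_def using \<rho>X(2)[OF that] R'I[OF Gu] by meson
  \<comment> \<open>\<open>steps\<close> of the old stage does not cover \<open>\<tau>\<close>.
    Endability replaces it: the run of \<open>g\<close> can be made long enough to survive the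
    removal of the prefix.\<close>
  have steppy_\<tau>: "steppy (\<tau>(h := yn))" unfolding steppy_def
  proof
    fix K
    obtain z where z: "(z, \<tau>) \<in> R" "z 0 = v" "\<And>l. l \<ge> 1 \<Longrightarrow> z l \<in> B"
      "\<And>l. q < l \<Longrightarrow> l \<le> q + (\<sigma> + L + \<rho> + 1 + K) \<Longrightarrow> z l = g"
      using q[of "\<sigma> + L + \<rho> + 1 + K"] by blast
    let ?w = "\<lambda>l. z (l + (\<sigma> + L + \<rho> + 1))"
    have "padded \<tau> v \<sigma> g L \<rho> ?w" using z \<sigma>(1) gB by (intro paddedI[of z]) auto
    then have "(?w, \<tau>(h := yn)) \<in> R'" by (rule R'I[OF Gy])
    moreover have "?w l = g" if "l < K" for l using z(4) \<sigma>(1) that by simp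
    ultimately show "\<exists>z. (z, \<tau>(h := yn)) \<in> R' \<and> (\<forall>l. z l \<in> B) \<and> (\<forall>l<K. z l = g)"
      using z(3) by (intro exI[of _ ?w]) auto
  qed
  have steppy_all: "steppy (p(h := yn))" if "p \<in> box D' h \<alpha>" for p
  proof -
    \<comment> \<open>From hub \<open>k\<close> on, \<open>p\<close> agrees with
      \<open>\<tau>\<close>. In the induction step the value \<open>y k\<close> is covered by
      \<open>PX\<close>, the value \<open>\<tau> k\<close> by the induction hypothesis, and these
      two generate \<open>D' k\<close>.\<close>
    have "\<And>p. p \<in> box D' h \<alpha> \<Longrightarrow> (\<And>c. k \<le> c \<Longrightarrow> p c = \<tau> c) \<Longrightarrow> steppy (p(h := yn))" if "k \<le> h" for k
      using that
    proof (induction k)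
      case 0
      then have "p = \<tau>" by auto
      then show ?case using steppy_\<tau> by metis
    next
      case (Suc k)
      then have k: "k < h" by simp
      have pP: "p \<in> P" using Suc.prems sub by auto
      have yk: "y k \<in> D' k" "\<tau> k \<in> D' k" "p k \<in> sg {y k, \<tau> k}"
        using k sg_sub[of "{y k, \<tau> k}"] Suc.prems(1) by (auto simp: D'_def box_def)
      have kA: "y k \<in> A" "\<tau> k \<in> A" using yk D'_A[of k] k by auto
      have in': "p(k := a) \<in> box D' h \<alpha>" if "a \<in> D' k" for a
        using Suc.prems(1) k that by (auto simp: box_def)
      have tw: "(p(k := a))(h := yn) = (p(h := yn))(k := a)" for a using k by (auto simp: fun_upd_twist)
      have "p(k := y k) \<in> PX" using in'[OF yk(1)] sub k by auto
      then have 1: "steppy ((p(h := yn))(k := y k))" using steppy_y unfolding tw[symmetric] by blast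
      have tk: "(p(k := \<tau> k)) c = \<tau> c" if "k \<le> c" for c
        using Suc.prems(2)[of c] that by (cases "c = k") auto
      have 2: "steppy ((p(h := yn))(k := \<tau> k))"
        unfolding tw[symmetric] by (rule Suc.IH[OF in'[OF yk(2)] tk]) (use k in simp_all)
      have "(p(h := yn)) c \<in> A" for c using box_A[OF pP] yA by simp
      then have "steppy ((p(h := yn))(k := p k))" by (rule steppy_line[OF _ 1 2 kA yk(3)])
      moreover have "(p(h := yn))(k := p k) = p(h := yn)" using k by auto
      ultimately show ?case by (simp only:)
    qed
    from this[of h p] that \<tau>(1) show ?thesis by (auto simp: box_def)
  qed
  have new_steps: "\<exists>z. (z, p') \<in> R' \<and> (\<forall>l. z l \<in> B) \<and> (\<forall>l<K. z l = g)"
    if p': "p' \<in> box D' (Suc h) \<alpha>" and c: "c < Suc h" "p' c = y' c" for p' c K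
  proof -
    let ?p = "p'(h := \<alpha>)"
    have p: "?p \<in> P" using restrict(1)[OF p'] sub by blast
    have "steppy p'"
    proof (cases "c = h")
      case True
      then have "p' = ?p(h := yn)" using c by (auto simp: y'_def)
      then show ?thesis using steppy_all[OF restrict(1)[OF p']] by metis
    next
      case False
      then have "c < h" "?p c = y c" using c by (simp_all add: y'_def)
      then have pX: "?p \<in> PX" using p by blast
      have "steppy (?p(h := p' h))"
        by (rule steppy_line[OF box_A[OF p] steppy_y[OF pX] steppy_u[OF pX] yA uA restrict(3)[OF p']])
      then show ?thesis by simp
    qed
    then show ?thesis unfolding steppy_def by blast
  qed
  have new_bad: "\<exists>l. z l \<notin> B"
    if zp: "(z, p') \<in> R'" and p': "p' \<in> box D' (Suc h) \<alpha>" and pB: "\<And>c. c < Suc h \<Longrightarrow> p' c \<in> B" for z p'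
  proof (rule ccontr)
    assume "\<not> ?thesis"
    then have zB: "\<And>l. z l \<in> B" by simp
    \<comment> \<open>Restoring the prefix yields an old sequence with a block of \<open>L\<close>
      entries \<open>gg\<close>, whose node starts a walk ending in \<open>B\<close>. The choice of
      \<open>L\<close> excludes this.\<close>
    obtain p gg vv x z0 where p: "p' = p(h := x)" "walk j gg vv x" and z0: "is_padded p vv \<sigma> gg L \<rho> z z0"
      using R'link[OF zp] unfolding padded_def by blast
    have z0R: "(z0, p) \<in> R" using z0 by (simp add: is_padded_def)
    have "p h = \<alpha>" using R_out[OF z0R] by simp
    then have "p = p'(h := \<alpha>)" using p(1) by auto
    then have pP: "p \<in> P" using restrict(1)[OF p'] sub by auto
    have "\<forall>l\<ge>1. z0 l \<in> B"
    proof (intro allI impI)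
      fix l :: nat assume "1 \<le> l"
      then consider "1 \<le> l" "l \<le> \<sigma>" | "\<sigma> < l" "l \<le> \<sigma> + L" | "\<sigma> + L < l" "l \<le> \<sigma> + L + \<rho>"
        | "\<sigma> + L + \<rho> + 1 \<le> l" by linarith
      then show "z0 l \<in> B"
      proof cases
        case 2
        then show ?thesis using z0 walk_in[OF p(2)] by (simp add: is_padded_def)
      next
        case 4
        then have "z0 l = z (l - (\<sigma> + L + \<rho> + 1))" using z0 unfolding is_padded_def by (metis le_add_diff_inverse2)
        then show ?thesis using zB by simp
      qed (use z0 in \<open>auto simp: is_padded_def\<close>)
    qed
    moreover have "\<forall>c<h. p c \<in> B"
    proof (intro allI impI)
      fix c assume "c < h"
      then show "p c \<in> B" using pB[of c] p(1) by auto
    qed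
    moreover have "x \<in> B" using pB[of h] p(1) by simp
    moreover have "z0 0 = vv" "\<forall>l. \<sigma> < l \<and> l \<le> \<sigma> + L \<longrightarrow> z0 l = gg"
      using z0 by (simp_all add: is_padded_def)
    ultimately show False using L[OF p(2) _ pP _ z0R] by blast
  qed
  have "stage A F B R' D' y' \<alpha> g \<zeta> (Suc h)"
  proof (intro stage.intro stage_axioms.intro idempotent_pair_axioms clR' \<alpha>B gB \<zeta>(1) D'_A new_rows new_steps new_bad)
    fix z p assume "(z, p) \<in> R'"
    then obtain p0 gg vv x z0 where p: "p = p0(h := x)" and z0: "is_padded p0 vv \<sigma> gg L \<rho> z z0"
      using R'link unfolding padded_def by blast
    then have z0R: "(z0, p0) \<in> R" by (simp add: is_padded_def)
    then obtain M where "\<forall>l\<ge>M. z0 l = \<alpha>" using R_ev by blast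
    then have "z l = \<alpha>" if "M \<le> l" for l
    proof -
      have "z l = z0 (l + (\<sigma> + L + \<rho> + 1))" using z0 by (simp add: is_padded_def)
      then show ?thesis using \<open>\<forall>l\<ge>M. z0 l = \<alpha>\<close> that by simp
    qed
    then show "\<exists>M. \<forall>l\<ge>M. z l = \<alpha>" by blast
    show "p c = \<alpha>" if "Suc h \<le> c" for c using R_out[OF z0R, of c] p that by simp
  next
    fix c assume c: "c < Suc h"
    show "closed_under F (D' c)" by (simp add: D'_def sg_closed)
    show "y' c \<in> D' c" using c sg_sub[of "{y c, \<tau> c}"] sg_sub[of "{yn, u}"]
      by (auto simp: D'_def y'_def less_Suc_eq)
    show "D' c \<inter> B \<noteq> {}" using c sg_sub[of "{y c, \<tau> c}"] sg_sub[of "{yn, u}"] \<tau>(2) u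
      by (auto simp: D'_def less_Suc_eq)
  qed
  then show ?thesis by blast
qed

end

context idempotent_pair
begin

section \<open>The equivalence\<close>

text \<open>Without hubs the box is a single constant tuple, \<open>steps\<close> is vacuous and
  \<open>bad\<close> is the property of the triple. The relation is the one generated by the
  rows.\<close>

lemma stage_0:
  assumes "a \<in> A" "b \<in> B" "b' \<in> B"
    and badt: "\<And>N t. t \<in> term_ops F N \<Longrightarrow> \<exists>l<N. t (map (\<lambda>i. row b a b' i l) [0..<N]) \<notin> B"
  shows "\<exists>R D y. stage A F B R D y b' b a 0"
proof -
  define R where "R = {(\<lambda>l. t (map (\<lambda>i. row b a b' i l) [0..<N]), \<lambda>_::nat. b') | t N. t \<in> term_ops F N}"
  have b'A: "b' \<in> A" using assms BA by auto
  have pad: "\<exists>t'\<in>term_ops F K. \<forall>l. t' (map (\<lambda>i. row b a b' i l) [0..<K]) = t (map (\<lambda>i. row b a b' i l) [0..<N])"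
    if t: "t \<in> term_ops F N" and "N \<le> K" for t N K
  proof
    show "(\<lambda>xs. t (map (\<lambda>i. xs ! i) [0..<N])) \<in> term_ops F K"
      using term_reindex[OF t, of "\<lambda>i. i" K] that by simp
    show "\<forall>l. t (map (\<lambda>i. map (\<lambda>i. row b a b' i l) [0..<K] ! i) [0..<N]) = t (map (\<lambda>i. row b a b' i l) [0..<N])"
      using that by (auto intro!: arg_cong[where f=t])
  qed
  have cl: "closed_rel R"
    unfolding closed_rel_def
  proof (intro allI ballI impI)
    fix m s and z p :: "nat \<Rightarrow> nat \<Rightarrow> 'a" assume s: "s \<in> term_ops F m" and zp: "\<forall>j<m. (z j, p j) \<in> R"
    have "\<forall>j. \<exists>N t. j < m \<longrightarrow> t \<in> term_ops F N \<and> z j = (\<lambda>l. t (map (\<lambda>i. row b a b' i l) [0..<N])) \<and> p j = (\<lambda>_. b')"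
      using zp unfolding R_def by blast
    then obtain N t where t: "\<And>j. j < m \<Longrightarrow> t j \<in> term_ops F (N j)"
      "\<And>j. j < m \<Longrightarrow> z j = (\<lambda>l. t j (map (\<lambda>i. row b a b' i l) [0..<N j]))" "\<And>j. j < m \<Longrightarrow> p j = (\<lambda>_. b')"
      by metis
    define K where "K = Max (insert 0 (N ` {..<m}))"
    have NK: "N j \<le> K" if "j < m" for j using that by (auto simp: K_def)
    have "\<forall>j. \<exists>t'. j < m \<longrightarrow> t' \<in> term_ops F K \<and> (\<forall>l. t' (map (\<lambda>i. row b a b' i l) [0..<K]) = z j l)"
      using pad[OF t(1) NK] t(2) by fastforce
    then obtain t' where t': "\<And>j. j < m \<Longrightarrow> t' j \<in> term_ops F K"
      "\<And>j l. j < m \<Longrightarrow> t' j (map (\<lambda>i. row b a b' i l) [0..<K]) = z j l" by metis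
    let ?s = "\<lambda>xs. s (map (\<lambda>j. t' j xs) [0..<m])"
    have "?s \<in> term_ops F K" using t'(1) by (intro term_subst[OF s])
    moreover have "(\<lambda>l. s (map (\<lambda>j. z j l) [0..<m])) = (\<lambda>l. ?s (map (\<lambda>i. row b a b' i l) [0..<K]))"
      using t'(2) by (auto intro!: arg_cong[where f=s])
    moreover have "(\<lambda>c. s (map (\<lambda>j. p j c) [0..<m])) = (\<lambda>_. b')"
      using t(3) by (auto intro!: term_const[OF s b'A])
    ultimately show "(\<lambda>l. s (map (\<lambda>j. z j l) [0..<m]), \<lambda>c. s (map (\<lambda>j. p j c) [0..<m])) \<in> R"
      unfolding R_def by (intro CollectI exI[of _ ?s] exI[of _ K]) simp
  qed
  have "stage A F B R (\<lambda>_. A) (\<lambda>_. b') b' b a 0"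
  proof (intro stage.intro stage_axioms.intro idempotent_pair_axioms cl assms(1-3))
    fix z p assume "(z, p) \<in> R"
    then obtain t N where t: "t \<in> term_ops F N" "z = (\<lambda>l. t (map (\<lambda>i. row b a b' i l) [0..<N]))" "p = (\<lambda>_. b')"
      unfolding R_def by blast
    have "z l = b'" if "l \<ge> N" for l
      unfolding t(2) using that by (intro term_const[OF t(1) b'A]) (auto simp: row_def)
    then show "\<exists>M. \<forall>l\<ge>M. z l = b'" by blast
    show "p c = b'" for c using t by simp
    show "\<exists>l. z l \<notin> B" using badt[OF t(1)] t(2) by blast
  next
    fix p :: "nat \<Rightarrow> 'a" and i assume "p \<in> box (\<lambda>_. A) 0 b'"
    then have p: "p = (\<lambda>_. b')" by (auto simp: box_def)
    have "row b a b' i = (\<lambda>l. (\<lambda>xs. xs ! i) (map (\<lambda>i. row b a b' i l) [0..<Suc i]))"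
      by (simp del: upt_Suc)
    then show "(row b a b' i, p) \<in> R" unfolding R_def p
      using term_ops.proj[of i "Suc i" F]
      by (intro CollectI exI[of _ "\<lambda>xs. xs ! i"] exI[of _ "Suc i"]) (simp del: upt_Suc)
  qed auto
  then show ?thesis by blast
qed

lemma jonsson_no_blocker_imp_absorbs:
  assumes J: "jonsson_absorbs A F B" and nb: "\<not> (\<exists>C D. blocker A F B C D)"
  shows "absorbs A F B"
proof (rule ccontr)
  assume "\<not> absorbs A F B"
  then obtain a b b' where abb: "a \<in> A" "b \<in> B" "b' \<in> B"
    "\<And>N t. t \<in> term_ops F N \<Longrightarrow> \<exists>l<N. t (map (\<lambda>i. row b a b' i l) [0..<N]) \<notin> B"
    by (rule not_absorbs_bad_triple) blast
  obtain n ds where n: "length ds = Suc n" and ds: "\<forall>d \<in> set ds. d \<in> term_ops F 3"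
    "\<forall>i \<le> n. \<forall>b \<in> B. \<forall>b' \<in> B. \<forall>a \<in> A. (ds ! i) [b, a, b'] \<in> B"
    "\<forall>i < n. \<forall>x \<in> A. \<forall>y \<in> A. (ds ! i) [x, y, y] = (ds ! Suc i) [x, x, y]"
    "\<forall>x \<in> A. \<forall>y \<in> A. \<forall>z \<in> A. (ds ! 0) [x, y, z] = x \<and> (ds ! n) [x, y, z] = z"
    using J unfolding jonsson_absorbs_def by (elim exE conjE) (rule that)
  have stages: "\<exists>R D y \<beta> \<xi>. stage A F B R D y b' \<beta> \<xi> h" for h
  proof (induction h)
    case 0
    then show ?case using stage_0[OF abb] by blast
  next
    case (Suc h)
    then obtain R D y \<beta> \<xi> where "stage A F B R D y b' \<beta> \<xi> h" by blast
    then interpret stage A F B R D y b' \<beta> \<xi> h .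
    interpret jonsson_stage A F B R D y b' \<beta> \<xi> h "\<lambda>k. ds ! k" n
      by unfold_locales (use n ds in auto)
    show ?case using next_stage .
  qed
  obtain N t where t: "t \<in> term_ops F N"
    and hit: "\<And>D y. closed_under F D \<Longrightarrow> D \<subseteq> A \<Longrightarrow> D \<inter> B \<noteq> {} \<Longrightarrow> y \<in> D \<Longrightarrow> hits t N D {y}"
    by (rule no_blocker_uniform_hits[OF nb]) blast
  obtain R D y \<beta> \<xi> where "stage A F B R D y b' \<beta> \<xi> N" using stages by blast
  then interpret stage A F B R D y b' \<beta> \<xi> N .
  have "\<forall>c. \<exists>e. c < N \<longrightarrow> (\<forall>i<N. e i \<in> D c) \<and> e c = y c \<and> t (map e [0..<N]) \<in> B"
    using hit[OF D_closed D_A D_B y_D] unfolding hits_def by blast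
  then obtain e where e: "\<And>c i. c < N \<Longrightarrow> i < N \<Longrightarrow> e c i \<in> D c" "\<And>c. c < N \<Longrightarrow> e c c = y c"
    "\<And>c. c < N \<Longrightarrow> t (map (e c) [0..<N]) \<in> B" by metis
  \<comment> \<open>This transposes the witnesses: \<open>e c\<close> lives over the single set
    \<open>D c\<close>, while \<open>p j\<close> collects the entries \<open>j\<close> across all
    hubs. Its entry at hub \<open>j\<close> is \<open>y j\<close>, so \<open>steps\<close> applies
    to every \<open>p j\<close>.\<close>
  define p where "p j c = (if c < N then e c j else b')" for j c
  have pP: "p j \<in> P" if "j < N" for j using e that by (auto simp: box_def p_def)
  have "\<exists>z. (z, p j) \<in> R \<and> (\<forall>l. z l \<in> B)" if "j < N" for j
    using steps[OF pP[OF that] that, of 0] e(2)[OF that] that by (auto simp: p_def)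
  then obtain z where z: "\<And>j. j < N \<Longrightarrow> (z j, p j) \<in> R" "\<And>j l. j < N \<Longrightarrow> z j l \<in> B" by metis
  have c1: "t (map (\<lambda>j. p j c) [0..<N]) = t (map (e c) [0..<N])" if "c < N" for c
    using that by (simp add: p_def)
  have c2: "t (map (\<lambda>j. p j c) [0..<N]) = b'" if "c \<ge> N" for c
    using that by (intro term_const[OF t]) (auto simp: p_def)
  have "\<exists>l. t (map (\<lambda>j. z j l) [0..<N]) \<notin> B"
  proof (rule bad[OF closed_relD[OF closed_R t z(1)]])
    show "(\<lambda>c. t (map (\<lambda>j. p j c) [0..<N])) \<in> P"
      using c1 c2 closed_underD[OF D_closed t e(1)] by (auto simp: box_def)
  qed (use c1 e(3) in auto)
  then obtain l where "t (map (\<lambda>j. z j l) [0..<N]) \<notin> B" ..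
  then show False using closed_underD[OF closed_B t, of "\<lambda>j. z j l"] z(2) by blast
qed

end

theorem theorem1p2:
  fixes A :: "'a set" and F :: "(nat \<times> ('a list \<Rightarrow> 'a)) set" and B :: "'a set"
  assumes "is_algebra A F" and "finite A" and "idempotent_alg A F"
    and "subuniverse A F B"
  shows "absorbs A F B \<longleftrightarrow>
           (jonsson_absorbs A F B \<and> \<not> (\<exists>C D. blocker A F B C D))"
proof -
  interpret idempotent_pair A F B using assms by unfold_locales
  show ?thesis
    using absorbs_imp_jonsson absorbs_imp_no_blocker jonsson_no_blocker_imp_absorbs by blast
qed

end
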